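(* Let $(h, \mathcal{E}, L)$ be an ENS- or UENS-refutation of $\mathcal{F}$ of degree $d$. Let $S := |\mathcal{E}|$ and assume $e^{h/p} \geq 2 S^2$. Then there is no $(d, h + \log S, S^{-1})$ pseudo-solution of $\mathcal{F}$. In particular, if $h$ is minimal such that $e^{h/p} \geq S^2$ holds then there is no $(d, (2p+1)\log S, S^{-1})$ pseudo-solution of $\mathcal{F}$.
   Context: Let $p$ be a fixed prime and $\mathbb{F}_p$ the $p$-element field. $\mathcal{F} \subseteq \mathbb{F}_p[\overline x]$ is a finite set of polynomials in variables $\overline x = x_1,\dots,x_N$ containing $x_i^2 - x_i$ for every variable. An NS-refutation of a set $\mathcal{G}$ of polynomials is a tuple $(h_g)_{g\in\mathcal{G}}$ of polynomials with $\sum_{g} h_g g = 1$ in the polynomial ring; its degree is $\max_g \deg(h_g g)$. Extension polynomials of accuracy $h$: for polynomials $\overline g = g_1,\dots,g_m$ and $i \le m$, $E_{i,\overline g} := g_i \cdot \prod_{u \le h}(1 - \sum_{j\le m} r_{uj} g_j)$, with new extension variables $r_{uj}$ common to all $i \le m$ (the $E_{j,\overline g}$, $j\le m$, are companions). A set $\mathcal{E}$ of such polynomials is stratified into levels $\mathcal{E}_1\cup\dots\cup\mathcal{E}_\ell$ if: companions lie in the same level; the $g_j$ in level 1 use only variables of $\mathcal{F}$ and their extension variables occur nowhere else (not in $\mathcal{F}$, nor in other level-1 polynomials except companions); the $g_j$ in level $t+1$ use only variables of $\mathcal{F}$ and of levels $\le t$, and their extension variables occur neither among these nor in other level-$(t+1)$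 polynomials except companions. $\mathcal{R}(\mathcal{E})$ is the set of polynomials $r^p - r$ for all extension variables $r$ in $\mathcal{E}$. An ENS-refutation of $\mathcal{F}$ is a triple $(h, \mathcal{E}, L)$ with $h\ge1$, $\mathcal{E}$ a stratified set of extension polynomials of accuracy $h$, and $L$ an NS-refutation of $\mathcal{F}\cup\mathcal{E}\cup\mathcal{R}(\mathcal{E})$; its degree is the degree of $L$. A UENS-refutation is a triple $(h,\mathcal{E},L)$ where $\mathcal{E}$ consists of unstructured extension polynomials of accuracy $h$, i.e. polynomials $(g_1 - r_1)\cdots(g_h - r_h)$ with no $r_i$ occurring in any $g_j$, satisfying $|\mathcal{E}| < e^{h/p}$, and $L$ is an NS-refutation of $\mathcal{F}\cup\mathcal{E}\cup\mathcal{R}(\mathcal{E})$; degree = degree of $L$. Let $\mathbb{F}_p[\overline x]_d$ be the space of polynomials of degree $\le d$. A degree $d$ $\mathcal{F}$-design is a map $\omega: \mathbb{F}_p[\overline x]_d \to \mathbb{F}_p$ with $\omega(a)=a$ for constants $a\in\mathbb{F}_p$, $\omega$ additive, and $\omega(fg)=0$ whenever $f\in\mathcal{F}$, $g \in \mathbb{F}_p[\overline x]_d$ and $\deg(fg)\le d$. A $(d,e)$-tree is a $p$-ary tree of height $\le e$ whose inner nodes query the value of some $g\in\mathbb{F}_p[\overline x]_d$, with outgoing edges labeled $g=a$, $a\in\mathbb{F}_p$, and leaves labeled by elements of some nonempty set; $T(\omega)$ is the leaf label reached by answering the queries by $\omega$. A conflict pair for $\omega$ is a pair $g,g'\in \mathbb{F}_p[\overline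 x]_d$ with $\deg(gg')\le d$ and $\omega(g)\omega(g')\ne\omega(gg')$. A $(d,e,\gamma)$-solution (pseudo-solution) of $\mathcal{F}$ is a nonempty finite set $\Omega$ of degree $d$ $\mathcal{F}$-designs such that for every $(d,e)$-tree $T$, $\Pr_{\omega\in\Omega}[T(\omega)$ is not a conflict pair for $\omega] \ge \gamma$. *)

theory Defs
  imports
    Complex_Main
    "HOL-Library.FuncSet"
    "HOL-Library.Poly_Mapping"
    "Berlekamp_Zassenhaus.Finite_Field"
begin

text \<open>
  Polynomials over the field with \<open>p = CARD('p)\<close> elements in countably many variables, indexed by
  \<^typ>\<open>nat\<close>; a monomial is the finitely supported map of its exponents. The variables of the system
  to be refuted are those with index below a bound \<open>N\<close>; extension variables have indices \<open>\<ge> N\<close>.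
\<close>

type_synonym 'p fpoly = "(nat \<Rightarrow>\<^sub>0 nat) \<Rightarrow>\<^sub>0 'p mod_ring"

definition Const :: "'p::prime_card mod_ring \<Rightarrow> 'p fpoly" where
  "Const a = Poly_Mapping.single 0 a"

definition Var :: "nat \<Rightarrow> 'p::prime_card fpoly" where
  "Var i = Poly_Mapping.single (Poly_Mapping.single i 1) 1"

definition vars :: "'p::prime_card fpoly \<Rightarrow> nat set" where
  "vars f = (\<Union>m\<in>Poly_Mapping.keys f. Poly_Mapping.keys m)"

text \<open>Total degree, with the convention that the zero polynomial has degree 0.\<close>

definition deg :: "'p::prime_card fpoly \<Rightarrow> nat" where
  "deg f = Max (insert 0 ((\<lambda>m. \<Sum>i\<in>Poly_Mapping.keys m. Poly_Mapping.lookup m i) ` Poly_Mapping.keys f))"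

definition polys :: "nat \<Rightarrow> 'p::prime_card fpoly set" where
  "polys N = {f. vars f \<subseteq> {..<N}}"

definition polys_upto :: "nat \<Rightarrow> nat \<Rightarrow> 'p::prime_card fpoly set" where
  "polys_upto N d = {f \<in> polys N. deg f \<le> d}"


subsection \<open>Nullstellensatz refutations\<close>

text \<open>The tuple of coefficients is a function, of which only the values on \<open>G\<close> matter.\<close>

definition ns_refutation :: "'p::prime_card fpoly set \<Rightarrow> ('p fpoly \<Rightarrow> 'p fpoly) \<Rightarrow> bool" where
  "ns_refutation G L \<longleftrightarrow> finite G \<and> (\<Sum>g\<in>G. L g * g) = 1"

definition ns_degree :: "'p::prime_card fpoly set \<Rightarrow> ('p fpoly \<Rightarrow> 'p fpoly) \<Rightarrow> nat" where
  "ns_degree G L = Max ((\<lambda>g. deg (L g * g)) ` G)"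

text \<open>The polynomials \<open>r\<^sup>p - r\<close> for the variables \<open>r\<close> in a given set.\<close>

definition field_eqs :: "nat set \<Rightarrow> 'p::prime_card fpoly set" where
  "field_eqs R = (\<lambda>r. Var r ^ CARD('p) - Var r) ` R"


subsection \<open>Stratified extension polynomials\<close>

text \<open>
  The list \<open>g\<^sub>1, \<dots>, g\<^sub>m\<close>, the extension variables \<open>r\<^sub>u\<^sub>j\<close> as a list of \<open>h\<close> rows of length \<open>m\<close>, and the
  selected index \<open>i\<close> (all indices counted from 0). Keeping this presentation beside the polynomial
  it denotes makes the extension variables well defined even if some of them cancel, as they do
  when \<open>g\<^sub>j = 0\<close>.
\<close>

datatype 'p ext = Ext (base: "'p fpoly list") (rows: "nat list list") (index: nat)

definition ext_wf :: "nat \<Rightarrow> 'p::prime_card ext \<Rightarrow> bool" where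
  "ext_wf h e \<longleftrightarrow> index e < length (base e) \<and> length (rows e) = h \<and>
     (\<forall>row\<in>set (rows e). length row = length (base e)) \<and> distinct (concat (rows e))"

definition ext_poly :: "'p::prime_card ext \<Rightarrow> 'p fpoly" where
  "ext_poly e = base e ! index e *
     (\<Prod>u<length (rows e). 1 - (\<Sum>j<length (base e). Var (rows e ! u ! j) * base e ! j))"

definition base_vars :: "'p::prime_card ext \<Rightarrow> nat set" where
  "base_vars e = (\<Union>g\<in>set (base e). vars g)"

definition ext_vars :: "'p::prime_card ext \<Rightarrow> nat set" where
  "ext_vars e = set (concat (rows e))"

definition companions :: "'p::prime_card ext \<Rightarrow> 'p ext \<Rightarrow> bool" where
  "companions e e' \<longleftrightarrow> base e = base e' \<and> rows e = rows e'"

text \<open>The variables available before level \<open>t\<close>; levels are counted from 1.\<close>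

definition vars_below :: "nat \<Rightarrow> (nat \<Rightarrow> 'p::prime_card ext set) \<Rightarrow> nat \<Rightarrow> nat set" where
  "vars_below N lev t = {..<N} \<union> (\<Union>s\<in>{1..<t}. \<Union>e\<in>lev s. base_vars e \<union> ext_vars e)"

definition stratified :: "nat \<Rightarrow> nat \<Rightarrow> 'p::prime_card ext set \<Rightarrow> bool" where
  "stratified N h D \<longleftrightarrow> finite D \<and> (\<forall>e\<in>D. ext_wf h e) \<and>
     (\<exists>l lev. D = (\<Union>t\<in>{1..l}. lev t) \<and>
       (\<forall>t\<in>{1..l}. \<forall>e\<in>lev t.
          (\<forall>e'\<in>D. companions e e' \<longrightarrow> e' \<in> lev t) \<and>
          base_vars e \<subseteq> vars_below N lev t \<and>
          ext_vars e \<inter> vars_below N lev t = {} \<and>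
          (\<forall>e'\<in>lev t. \<not> companions e e' \<longrightarrow> ext_vars e \<inter> (base_vars e' \<union> ext_vars e') = {})))"

text \<open>\<open>(h, E, L)\<close> is an ENS-refutation of \<open>F\<close> of degree \<open>d\<close>.\<close>

definition ens_refutation ::
  "nat \<Rightarrow> 'p::prime_card fpoly set \<Rightarrow> nat \<Rightarrow> 'p fpoly set \<Rightarrow> ('p fpoly \<Rightarrow> 'p fpoly) \<Rightarrow> nat \<Rightarrow> bool"
where
  "ens_refutation N F h E L d \<longleftrightarrow> 1 \<le> h \<and>
     (\<exists>D. stratified N h D \<and> E = ext_poly ` D \<and>
        (let G = F \<union> E \<union> field_eqs (\<Union>e\<in>D. ext_vars e)
         in ns_refutation G L \<and> ns_degree G L = d))"


subsection \<open>Unstructured extension polynomials\<close>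

text \<open>
  \<open>(g\<^sub>1 - r\<^sub>1) \<cdots> (g\<^sub>h - r\<^sub>h)\<close> is presented by the list of the pairs \<open>(g\<^sub>i, r\<^sub>i)\<close>. The \<open>r\<^sub>i\<close> are pairwise
  distinct and are not variables of the refuted system; different extension polynomials may
  share extension variables.
\<close>

definition uext_wf :: "nat \<Rightarrow> nat \<Rightarrow> ('p::prime_card fpoly \<times> nat) list \<Rightarrow> bool" where
  "uext_wf N h e \<longleftrightarrow> length e = h \<and> distinct (map snd e) \<and>
     (\<forall>r\<in>set (map snd e). N \<le> r \<and> (\<forall>g\<in>set (map fst e). r \<notin> vars g))"

definition uext_poly :: "('p::prime_card fpoly \<times> nat) list \<Rightarrow> 'p fpoly" where
  "uext_poly e = (\<Prod>(g, r)\<leftarrow>e. g - Var r)"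

text \<open>\<open>(h, E, L)\<close> is a UENS-refutation of \<open>F\<close> of degree \<open>d\<close>.\<close>

definition uens_refutation ::
  "nat \<Rightarrow> 'p::prime_card fpoly set \<Rightarrow> nat \<Rightarrow> 'p fpoly set \<Rightarrow> ('p fpoly \<Rightarrow> 'p fpoly) \<Rightarrow> nat \<Rightarrow> bool"
where
  "uens_refutation N F h E L d \<longleftrightarrow>
     (\<exists>D. finite D \<and> (\<forall>e\<in>D. uext_wf N h e) \<and> E = uext_poly ` D \<and>
        real (card E) < exp (real h / real CARD('p)) \<and>
        (let G = F \<union> E \<union> field_eqs (\<Union>e\<in>D. set (map snd e))
         in ns_refutation G L \<and> ns_degree G L = d))"


subsection \<open>Designs, trees and pseudo-solutions\<close>

text \<open>
  A design is a map with domain \<^term>\<open>polys_upto N d\<close>; extensionality ensures that designs are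
  counted as such maps, irrespective of values elsewhere.
\<close>

definition design ::
  "nat \<Rightarrow> 'p::prime_card fpoly set \<Rightarrow> nat \<Rightarrow> ('p fpoly \<Rightarrow> 'p mod_ring) \<Rightarrow> bool" where
  "design N F d w \<longleftrightarrow> w \<in> extensional (polys_upto N d) \<and>
     (\<forall>a. w (Const a) = a) \<and>
     (\<forall>f\<in>polys_upto N d. \<forall>g\<in>polys_upto N d. w (f + g) = w f + w g) \<and>
     (\<forall>f\<in>F. \<forall>g\<in>polys_upto N d. deg (f * g) \<le> d \<longrightarrow> w (f * g) = 0)"

text \<open>Trees with queries of type \<open>'q\<close>, one subtree per answer in \<open>'a\<close>, and leaf labels in \<open>'l\<close>.\<close>

datatype ('q, 'a, 'l) qtree = Leaf 'l | Query 'q "'a \<Rightarrow> ('q, 'a, 'l) qtree"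

primrec height :: "('q, 'a::finite, 'l) qtree \<Rightarrow> nat" where
  "height (Leaf x) = 0"
| "height (Query q ts) = Suc (Max (range (\<lambda>a. height (ts a))))"

primrec queries :: "('q, 'a, 'l) qtree \<Rightarrow> 'q set" where
  "queries (Leaf x) = {}"
| "queries (Query q ts) = insert q (\<Union>a. queries (ts a))"

primrec run :: "('q, 'a, 'l) qtree \<Rightarrow> ('q \<Rightarrow> 'a) \<Rightarrow> 'l" where
  "run (Leaf x) w = x"
| "run (Query q ts) w = run (ts (w q)) w"

text \<open>
  Leaves are labelled by pairs of arbitrary polynomials, which need not be conflict pairs; any other
  label may be replaced by the pair \<open>(0, 0)\<close>, which is never a conflict pair for a design.
\<close>

type_synonym 'p ptree = "('p fpoly, 'p mod_ring, 'p fpoly \<times> 'p fpoly) qtree"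

definition is_tree :: "nat \<Rightarrow> nat \<Rightarrow> real \<Rightarrow> 'p::prime_card ptree \<Rightarrow> bool" where
  "is_tree N d e T \<longleftrightarrow> queries T \<subseteq> polys_upto N d \<and> real (height T) \<le> e"

definition conflict_pair ::
  "nat \<Rightarrow> nat \<Rightarrow> ('p::prime_card fpoly \<Rightarrow> 'p mod_ring) \<Rightarrow> 'p fpoly \<times> 'p fpoly \<Rightarrow> bool" where
  "conflict_pair N d w = (\<lambda>(g, g'). g \<in> polys_upto N d \<and> g' \<in> polys_upto N d \<and>
     deg (g * g') \<le> d \<and> w g * w g' \<noteq> w (g * g'))"

definition pseudo_solution ::
  "nat \<Rightarrow> 'p::prime_card fpoly set \<Rightarrow> nat \<Rightarrow> real \<Rightarrow> real \<Rightarrow> ('p fpoly \<Rightarrow> 'p mod_ring) set \<Rightarrow> bool"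
where
  "pseudo_solution N F d e \<gamma> \<Omega> \<longleftrightarrow> finite \<Omega> \<and> \<Omega> \<noteq> {} \<and> (\<forall>w\<in>\<Omega>. design N F d w) \<and>
     (\<forall>T. is_tree N d e T \<longrightarrow>
        real (card {w \<in> \<Omega>. \<not> conflict_pair N d w (run T w)}) / real (card \<Omega>) \<ge> \<gamma>)"

end

theory Submission
  imports Defs "HOL-Computational_Algebra.Polynomial"
begin

text \<open>
  Both kinds of extension polynomials have the form \<open>q * (\<Prod>u<h. b u - Var (v u) * q)\<close> with
  variables \<open>v u\<close> that occur neither in \<open>q\<close> nor in any \<open>b u'\<close>: in the stratified case \<open>q = g\<^sub>i\<close> and
  \<open>v u = r\<^sub>u\<^sub>i\<close>, in the unstructured case \<open>q = 1\<close>. Assign random constants to all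
  variables outside the refuted system. If a design \<open>w\<close> does not annihilate the specialized \<open>q\<close>,
  then for exactly one value of \<open>v u\<close> it annihilates the specialized factor \<open>b u - Var (v u) * q\<close>;
  hence \<open>w\<close> annihilates none of \<open>q\<close> and the first \<open>k\<close> such factors with probability at most
  \<open>(1 - 1/p)^k\<close>. By averaging, some assignment is good for all extension polynomials and all but a
  fraction \<open>S * (1 - 1/p)^k\<close> of the designs.

  Under this assignment the refutation becomes an identity in which the extension terms alone carry
  the value \<open>w 1 = 1\<close>. Binary search with \<open>\<lceil>log S\<rceil>\<close> queries finds a term on which \<open>w\<close> does not
  vanish, and \<open>k\<close> further queries single out an annihilated factor among \<open>k + 1\<close>, the last one being
  deduced without a query. This factor and its cofactor form a conflict pair. The first claim takes
  \<open>k = h - 1\<close>, which saves the query lost in rounding \<open>log S\<close> up; the second takes \<open>k = h\<close>.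
\<close>

subsection \<open>Homomorphisms from monoid algebras\<close>

lemma poly_mapping_eq_sum_single:
  "f = (\<Sum>m\<in>Poly_Mapping.keys f. Poly_Mapping.single m (Poly_Mapping.lookup f m))"
  by (rule poly_mapping_eqI)
     (auto simp: lookup_sum lookup_single when_def in_keys_iff)

text \<open>A monoid algebra is universal: a ring map on coefficients and a monoid map on monomials
  extend to one ring map. Two instances follow, homogenization and the specialization of
  variables.\<close>

locale monomial_hom =
  fixes c :: "'a::comm_ring_1 \<Rightarrow> 'r::comm_ring_1"
    and \<phi> :: "'m::comm_monoid_add \<Rightarrow> 'r"
  assumes c_add: "c (x + y) = c x + c y"
    and c_mult: "c (x * y) = c x * c y"
    and c_1: "c 1 = 1"
    and \<phi>_0: "\<phi> 0 = 1"
    and \<phi>_add: "\<phi> (m + n) = \<phi> m * \<phi> n"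
begin

definition lift :: "('m \<Rightarrow>\<^sub>0 'a) \<Rightarrow> 'r" where
  "lift f = (\<Sum>m\<in>Poly_Mapping.keys f. c (Poly_Mapping.lookup f m) * \<phi> m)"

lemma c_0: "c 0 = 0"
  using c_add[of 0 0] by simp

lemma lift_superset:
  assumes "finite M" "Poly_Mapping.keys f \<subseteq> M"
  shows "lift f = (\<Sum>m\<in>M. c (Poly_Mapping.lookup f m) * \<phi> m)"
  unfolding lift_def
  by (rule sum.mono_neutral_left) (use assms in \<open>auto simp: in_keys_iff c_0\<close>)

lemma lift_add: "lift (f + g) = lift f + lift g"
proof -
  let ?M = "Poly_Mapping.keys f \<union> Poly_Mapping.keys g"
  have "lift (f + g) = (\<Sum>m\<in>?M. c (Poly_Mapping.lookup (f + g) m) * \<phi> m)"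
    by (rule lift_superset) (auto simp: keys_add)
  also have "\<dots> = lift f + lift g"
    by (simp add: lift_superset[of ?M f] lift_superset[of ?M g] lookup_add c_add
        sum.distrib distrib_right)
  finally show ?thesis .
qed

lemma lift_single: "lift (Poly_Mapping.single m x) = c x * \<phi> m"
  by (cases "x = 0") (simp_all add: lift_def c_0)

lemma lift_0: "lift 0 = 0"
  by (simp add: lift_def)

lemma lift_1: "lift 1 = 1"
  using lift_single[of 0 1] by (simp add: c_1 \<phi>_0)

lemma lift_sum: "lift (\<Sum>i\<in>I. f i) = (\<Sum>i\<in>I. lift (f i))"
  by (induction I rule: infinite_finite_induct) (auto simp: lift_0 lift_add)

lemma lift_mult: "lift (f * g) = lift f * lift g"
proof -
  let ?s = "\<lambda>f m. Poly_Mapping.single m (Poly_Mapping.lookup f m)"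
  \<comment> \<open>Multiplicativity is reduced to terms: first \<open>g\<close> is expanded against
    a single term on the left, then \<open>f\<close> is expanded.\<close>
  have single: "lift (Poly_Mapping.single m x * g) = c x * \<phi> m * lift g" for m x
  proof -
    have "lift (Poly_Mapping.single m x * (\<Sum>n\<in>Poly_Mapping.keys g. ?s g n)) =
      c x * \<phi> m * lift g"
      by (simp add: sum_distrib_left lift_sum mult_single lift_single c_mult \<phi>_add
          lift_def[of g] algebra_simps)
    then show ?thesis
      using poly_mapping_eq_sum_single[of g] by simp
  qed
  have "lift ((\<Sum>m\<in>Poly_Mapping.keys f. ?s f m) * g) = lift f * lift g"
    by (simp add: sum_distrib_right lift_sum single lift_def[of f])
  then show ?thesis
    using poly_mapping_eq_sum_single[of f] by simp
qed

lemma lift_minus: "lift (f - g) = lift f - lift g"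
  using lift_add[of "f - g" g] by (simp add: algebra_simps)

lemma lift_power: "lift (f ^ n) = lift f ^ n"
  by (induction n) (auto simp: lift_1 lift_mult)

end

subsection \<open>Variables and degree\<close>

lemma vars_0 [simp]: "vars 0 = {}"
  and vars_Const [simp]: "vars (Const x) = {}"
  and vars_1 [simp]: "vars 1 = {}"
  and vars_Var [simp]: "vars (Var i) = {i}"
  by (auto simp: vars_def Const_def Var_def)

lemma vars_add: "vars (f + g) \<subseteq> vars f \<union> vars g"
  using keys_add[of f g] by (fastforce simp: vars_def)

lemma vars_minus: "vars (f - g) \<subseteq> vars f \<union> vars g"
  using keys_diff[of f g] by (fastforce simp: vars_def)

lemma vars_mult: "vars (f * g) \<subseteq> vars f \<union> vars g"
proof
  fix i assume "i \<in> vars (f * g)"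
  then obtain m n where "m \<in> Poly_Mapping.keys f" "n \<in> Poly_Mapping.keys g"
    "i \<in> Poly_Mapping.keys (m + n)"
    using keys_mult[of f g] by (fastforce simp: vars_def)
  then show "i \<in> vars f \<union> vars g"
    using keys_add[of m n] by (auto simp: vars_def)
qed

lemma vars_sum: "vars (\<Sum>i\<in>I. f i) \<subseteq> (\<Union>i\<in>I. vars (f i))"
  by (induction I rule: infinite_finite_induct) (use vars_add in \<open>fastforce+\<close>)

lemma vars_prod: "vars (\<Prod>i\<in>I. f i) \<subseteq> (\<Union>i\<in>I. vars (f i))"
  by (induction I rule: infinite_finite_induct) (use vars_mult in \<open>fastforce+\<close>)

lemma vars_power: "vars (f ^ n) \<subseteq> vars f"
  by (induction n) (use vars_mult in \<open>fastforce+\<close>)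

section \<open>Total degree of monomials and polynomials\<close>

definition mdeg :: "(nat \<Rightarrow>\<^sub>0 nat) \<Rightarrow> nat" where
  "mdeg m = (\<Sum>i\<in>Poly_Mapping.keys m. Poly_Mapping.lookup m i)"

lemma mdeg_superset:
  "finite I \<Longrightarrow> Poly_Mapping.keys m \<subseteq> I \<Longrightarrow> mdeg m = (\<Sum>i\<in>I. Poly_Mapping.lookup m i)"
  unfolding mdeg_def by (rule sum.mono_neutral_left) (auto simp: in_keys_iff)

lemma mdeg_add: "mdeg (m + n) = mdeg m + mdeg n"
proof -
  let ?I = "Poly_Mapping.keys m \<union> Poly_Mapping.keys n"
  have "mdeg (m + n) = (\<Sum>i\<in>?I. Poly_Mapping.lookup (m + n) i)"
    by (rule mdeg_superset) (auto simp: keys_add)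
  then show ?thesis
    by (simp add: mdeg_superset[of ?I m] mdeg_superset[of ?I n] lookup_add sum.distrib)
qed

lemma deg_le_iff: "deg f \<le> d \<longleftrightarrow> (\<forall>m\<in>Poly_Mapping.keys f. mdeg m \<le> d)"
  by (auto simp: deg_def mdeg_def)

lemma mdeg_le_deg: "m \<in> Poly_Mapping.keys f \<Longrightarrow> mdeg m \<le> deg f"
  using deg_le_iff[of f "deg f"] by simp

lemma deg_0 [simp]: "deg 0 = 0"
  and deg_Const [simp]: "deg (Const x) = 0"
  and deg_1 [simp]: "deg 1 = 0"
  and deg_Var [simp]: "deg (Var i) = 1"
  by (auto simp: deg_def Const_def Var_def)

lemma deg_add_le: "deg (f + g) \<le> max (deg f) (deg g)"
  unfolding deg_le_iff using keys_add[of f g] mdeg_le_deg by (fastforce simp: le_max_iff_disj)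

lemma deg_mult_le: "deg (f * g) \<le> deg f + deg g"
  unfolding deg_le_iff
proof
  fix k assume "k \<in> Poly_Mapping.keys (f * g)"
  then obtain m n where "k = m + n" "m \<in> Poly_Mapping.keys f" "n \<in> Poly_Mapping.keys g"
    using keys_mult[of f g] by blast
  then show "mdeg k \<le> deg f + deg g"
    using mdeg_le_deg[of m f] mdeg_le_deg[of n g] by (simp add: mdeg_add)
qed

lemma deg_prod_le: "deg (\<Prod>i\<in>I. f i) \<le> (\<Sum>i\<in>I. deg (f i))"
proof (induction I rule: infinite_finite_induct)
  case (insert i I)
  then show ?case using deg_mult_le[of "f i" "prod f I"] by simp
qed auto

lemma deg_sum_le: "(\<And>i. i \<in> I \<Longrightarrow> deg (f i) \<le> d) \<Longrightarrow> deg (\<Sum>i\<in>I. f i) \<le> d"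
proof (induction I rule: infinite_finite_induct)
  case (insert i I)
  then show ?case using deg_add_le[of "f i" "sum f I"] by force
qed auto

lemma deg_power_le: "deg (f ^ n) \<le> n * deg f"
proof (induction n)
  case (Suc n)
  then show ?case using deg_mult_le[of f "f ^ n"] by simp
qed auto

lemma Const_0 [simp]: "Const 0 = 0"
  and Const_1 [simp]: "Const 1 = 1"
  and Const_add: "Const (x + y) = Const x + Const y"
  and Const_mult: "Const (x * y) = Const x * Const y"
  by (simp_all add: Const_def single_add mult_single)

definition graded_monom :: "(nat \<Rightarrow>\<^sub>0 nat) \<Rightarrow> 'p::prime_card fpoly poly" where
  "graded_monom m = monom (Poly_Mapping.single m 1) (mdeg m)"

text \<open>
  Recording the total degree of each monomial as the exponent of one further indeterminate is an
  injective ring homomorphism into univariate polynomials over a domain, hence degrees add.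
\<close>

interpretation homogenize: monomial_hom "\<lambda>x. [:Const x:]" graded_monom
proof
  show "graded_monom 0 = 1"
    by (simp add: graded_monom_def mdeg_def)
  show "graded_monom (m + n) = graded_monom m * graded_monom n" for m n
    by (simp add: graded_monom_def mdeg_add mult_monom mult_single)
qed (simp_all add: Const_add Const_mult one_pCons)

text \<open>The coefficient at exponent \<open>k\<close> is the homogeneous component of degree
  \<open>k\<close>; distinct monomials keep distinct keys, so nothing cancels. Both the degree
  formula and injectivity are read off from this.\<close>

lemma lookup_coeff_homogenize:
  "Poly_Mapping.lookup (coeff (homogenize.lift f) k) m = (Poly_Mapping.lookup f m when mdeg m = k)"
proof -
  have "coeff (homogenize.lift f) k = (\<Sum>m\<in>Poly_Mapping.keys f.
      Poly_Mapping.single m (Poly_Mapping.lookup f m when mdeg m = k))"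
    unfolding homogenize.lift_def coeff_sum
    by (intro sum.cong refl) (simp add: graded_monom_def Const_def smult_monom mult_single when_def)
  then show ?thesis
    by (auto simp: lookup_sum lookup_single when_def in_keys_iff)
qed

lemma degree_homogenize: "degree (homogenize.lift f) = deg f"
proof (rule antisym)
  show "degree (homogenize.lift f) \<le> deg f"
  proof (rule degree_le, intro allI impI)
    fix k assume "deg f < k"
    then have "Poly_Mapping.lookup (coeff (homogenize.lift f) k) m = 0" for m
      using mdeg_le_deg[of m f] by (force simp: lookup_coeff_homogenize when_def in_keys_iff)
    then show "coeff (homogenize.lift f) k = 0"
      by (simp add: poly_mapping_eqI)
  qed
  show "deg f \<le> degree (homogenize.lift f)"
    unfolding deg_le_iff
  proof
    fix m assume "m \<in> Poly_Mapping.keys f"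
    then have "Poly_Mapping.lookup (coeff (homogenize.lift f) (mdeg m)) m \<noteq> 0"
      by (simp add: lookup_coeff_homogenize in_keys_iff)
    then show "mdeg m \<le> degree (homogenize.lift f)"
      by (intro le_degree) auto
  qed
qed

lemma homogenize_eq_0_iff: "homogenize.lift f = 0 \<longleftrightarrow> f = 0"
proof
  assume "homogenize.lift f = 0"
  then have "Poly_Mapping.lookup f m = 0" for m
    using lookup_coeff_homogenize[of f "mdeg m" m] by simp
  then show "f = 0"
    by (simp add: poly_mapping_eqI)
qed (simp add: homogenize.lift_0)

text \<open>A degree bound on a nonzero product passes to its factors. This keeps the factors of
  each refutation term inside the domain of a degree \<open>d\<close> design.\<close>

lemma deg_mult_eq: "f \<noteq> 0 \<Longrightarrow> g \<noteq> 0 \<Longrightarrow> deg (f * g) = deg f + deg g"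
  unfolding degree_homogenize[symmetric] homogenize.lift_mult
  by (rule degree_mult_eq) (simp_all add: homogenize_eq_0_iff)

subsection \<open>Assigning constants to the extension variables\<close>

definition specialize_var :: "nat \<Rightarrow> (nat \<Rightarrow> 'p mod_ring) \<Rightarrow> nat \<Rightarrow> 'p::prime_card fpoly" where
  "specialize_var N a i = (if i < N then Var i else Const (a i))"

lemma prod_power_lookup_superset:
  fixes \<sigma> :: "nat \<Rightarrow> 'r::comm_ring_1"
  assumes "finite I" "Poly_Mapping.keys m \<subseteq> I"
  shows "(\<Prod>i\<in>Poly_Mapping.keys m. \<sigma> i ^ Poly_Mapping.lookup m i) = (\<Prod>i\<in>I. \<sigma> i ^ Poly_Mapping.lookup m i)"
  by (rule prod.mono_neutral_left) (use assms in \<open>auto simp: in_keys_iff\<close>)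

lemma prod_power_lookup_add:
  fixes \<sigma> :: "nat \<Rightarrow> 'r::comm_ring_1"
  shows "(\<Prod>i\<in>Poly_Mapping.keys (m + n). \<sigma> i ^ Poly_Mapping.lookup (m + n) i) =
    (\<Prod>i\<in>Poly_Mapping.keys m. \<sigma> i ^ Poly_Mapping.lookup m i) *
    (\<Prod>i\<in>Poly_Mapping.keys n. \<sigma> i ^ Poly_Mapping.lookup n i)"
proof -
  let ?I = "Poly_Mapping.keys m \<union> Poly_Mapping.keys n"
  have "(\<Prod>i\<in>Poly_Mapping.keys (m + n). \<sigma> i ^ Poly_Mapping.lookup (m + n) i) =
     (\<Prod>i\<in>?I. \<sigma> i ^ Poly_Mapping.lookup (m + n) i)"
    by (rule prod_power_lookup_superset) (auto simp: keys_add)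
  then show ?thesis
    by (simp add: prod_power_lookup_superset[of ?I m] prod_power_lookup_superset[of ?I n]
        lookup_add power_add prod.distrib)
qed

definition specialize_monom ::
  "nat \<Rightarrow> (nat \<Rightarrow> 'p mod_ring) \<Rightarrow> (nat \<Rightarrow>\<^sub>0 nat) \<Rightarrow> 'p::prime_card fpoly" where
  "specialize_monom N a m = (\<Prod>i\<in>Poly_Mapping.keys m. specialize_var N a i ^ Poly_Mapping.lookup m i)"

interpretation spec: monomial_hom Const "specialize_monom N a" for N a
  by unfold_locales
    (simp_all add: Const_add Const_mult prod_power_lookup_add specialize_monom_def)

abbreviation specialize :: "nat \<Rightarrow> (nat \<Rightarrow> 'p mod_ring) \<Rightarrow> 'p::prime_card fpoly \<Rightarrow> 'p fpoly" where
  "specialize \<equiv> spec.lift"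

lemma specialize_Var: "specialize N a (Var i) = specialize_var N a i"
  by (simp add: Var_def spec.lift_single specialize_monom_def)

lemma specialize_Const: "specialize N a (Const x) = Const x"
  by (simp add: Const_def[of x] spec.lift_single specialize_monom_def)

lemma specialize_cong:
  assumes "\<And>i. i \<in> vars f \<Longrightarrow> N \<le> i \<Longrightarrow> a i = b i"
  shows "specialize N a f = specialize N b f"
proof -
  have "specialize_var N a i = specialize_var N b i" if "i \<in> vars f" for i
    using assms[OF that] by (simp add: specialize_var_def)
  then show ?thesis
    unfolding spec.lift_def specialize_monom_def
    by (intro sum.cong prod.cong arg_cong2[where f = "(*)"] refl) (metis UN_I vars_def)
qed

lemma Var_power: "Var i ^ n = Poly_Mapping.single (Poly_Mapping.single i n) 1"
  by (induction n) (auto simp: Var_def mult_single single_add[symmetric])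

lemma prod_Var_power:
  "finite I \<Longrightarrow> (\<Prod>i\<in>I. Var i ^ n i) = Poly_Mapping.single (\<Sum>i\<in>I. Poly_Mapping.single i (n i)) 1"
  by (induction I rule: finite_induct) (auto simp: Var_power mult_single)

lemma specialize_ident:
  assumes "f \<in> polys N"
  shows "specialize N a f = f"
proof -
  have "specialize_var N a i = Var i" if "i \<in> vars f" for i
    using assms that by (auto simp: specialize_var_def polys_def)
  then have "specialize N a f = (\<Sum>m\<in>Poly_Mapping.keys f. Const (Poly_Mapping.lookup f m) *
     (\<Prod>i\<in>Poly_Mapping.keys m. Var i ^ Poly_Mapping.lookup m i))"
    unfolding spec.lift_def specialize_monom_def
    by (intro sum.cong prod.cong arg_cong2[where f = "(*)"] refl) (metis UN_I vars_def)
  also have "\<dots> = (\<Sum>m\<in>Poly_Mapping.keys f. Poly_Mapping.single m (Poly_Mapping.lookup f m))"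
    by (intro sum.cong refl)
      (simp add: prod_Var_power poly_mapping_eq_sum_single[symmetric] Const_def mult_single)
  finally show ?thesis
    by (simp add: poly_mapping_eq_sum_single[symmetric])
qed

lemma specialize_in_polys: "specialize N a f \<in> polys N"
proof -
  have "vars (specialize_var N a i) \<subseteq> {..<N}" for i
    by (simp add: specialize_var_def)
  then have "vars (\<Prod>i\<in>I. specialize_var N a i ^ n i) \<subseteq> {..<N}" for I n
    using vars_prod[of "\<lambda>i. specialize_var N a i ^ n i" I] vars_power by blast
  then have "vars (Const x * (\<Prod>i\<in>I. specialize_var N a i ^ n i)) \<subseteq> {..<N}" for I n x
    using vars_mult[of "Const x" "\<Prod>i\<in>I. specialize_var N a i ^ n i"] by auto
  then show ?thesis
    unfolding polys_def spec.lift_def specialize_monom_def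
    using vars_sum[of "\<lambda>m. Const (Poly_Mapping.lookup f m) *
      (\<Prod>i\<in>Poly_Mapping.keys m. specialize_var N a i ^ Poly_Mapping.lookup m i)" "Poly_Mapping.keys f"]
    by blast
qed

text \<open>Each variable becomes a variable or a constant, both of degree at most 1, so no monomial
  gains degree.\<close>

lemma deg_specialize_le: "deg (specialize N a f) \<le> deg f"
  unfolding spec.lift_def specialize_monom_def
proof (rule deg_sum_le)
  fix m assume m: "m \<in> Poly_Mapping.keys f"
  let ?P = "\<lambda>i. specialize_var N a i ^ Poly_Mapping.lookup m i"
  have "deg (Const (Poly_Mapping.lookup f m) * (\<Prod>i\<in>Poly_Mapping.keys m. ?P i)) \<le>
      (\<Sum>i\<in>Poly_Mapping.keys m. deg (?P i))"
    using deg_mult_le[of "Const (Poly_Mapping.lookup f m)"] deg_prod_le[of ?P "Poly_Mapping.keys m"]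
    by (metis (no_types, lifting) add_0 deg_Const order_trans)
  also have "\<dots> \<le> mdeg m"
    unfolding mdeg_def
  proof (rule sum_mono)
    fix i
    have "deg (specialize_var N a i) \<le> 1"
      by (simp add: specialize_var_def)
    then show "deg (?P i) \<le> Poly_Mapping.lookup m i"
      using deg_power_le[of "specialize_var N a i" "Poly_Mapping.lookup m i"]
      by (metis (no_types, lifting) mult.right_neutral mult_le_mono2 order_trans)
  qed
  also have "\<dots> \<le> deg f"
    by (rule mdeg_le_deg[OF m])
  finally show "deg (Const (Poly_Mapping.lookup f m) * (\<Prod>i\<in>Poly_Mapping.keys m. ?P i)) \<le> deg f" .
qed

text \<open>Once \<open>r\<close> is replaced by a constant \<open>x\<close>, this is Fermat's
  identity \<open>x ^ CARD('a) = x\<close> in the prime field.\<close>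

lemma specialize_field_eqs:
  assumes "f \<in> field_eqs R" "\<And>r. r \<in> R \<Longrightarrow> N \<le> r"
  shows "specialize N a f = 0"
proof -
  obtain r where "f = Var r ^ CARD('a) - Var r" "N \<le> r"
    using assms by (auto simp: field_eqs_def)
  moreover have "Const x ^ n = Const (x ^ n)" for x :: "'a mod_ring" and n
    by (induction n) (simp_all add: Const_mult)
  ultimately show ?thesis
    using finite_field_power_card_eq_same[where ?'a = "'a mod_ring"]
    by (simp add: spec.lift_minus spec.lift_power specialize_Var specialize_var_def)
qed


subsection \<open>Counting\<close>

text \<open>The set \<open>B\<close> is a union of lines in direction \<open>v\<close>, and on each
  line at least one of the \<open>CARD('v)\<close> points fails \<open>P\<close>.\<close>

lemma card_line_le:
  fixes B :: "('i \<Rightarrow> 'v::finite) set"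
  assumes "finite B"
    and closed: "\<And>a x. a \<in> B \<Longrightarrow> a(v := x) \<in> B"
    and kill: "\<And>a. a \<in> B \<Longrightarrow> \<exists>x. \<not> P (a(v := x))"
  shows "real (card {a \<in> B. P a}) \<le> (1 - 1 / real CARD('v)) * real (card B)"
proof -
  let ?K = "{a \<in> B. \<not> P a}"
  obtain x where x: "\<And>a. a \<in> B \<Longrightarrow> \<not> P (a(v := x a))"
    using kill by metis
  \<comment> \<open>The line of \<open>a\<close> is recovered from its chosen failing point and the
    position on it from \<open>a v\<close>, so this map is injective.\<close>
  let ?f = "\<lambda>a. (a v, a(v := x a))"
  have "inj_on ?f B"
  proof (rule inj_onI)
    fix a a' assume *: "?f a = ?f a'"
    have "a = (a(v := x a))(v := a v)" by simp
    also have "\<dots> = a'" using * by auto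
    finally show "a = a'" .
  qed
  moreover have "?f ` B \<subseteq> UNIV \<times> ?K"
    using x closed by auto
  ultimately have "card B \<le> card ((UNIV :: 'v set) \<times> ?K)"
    using \<open>finite B\<close> by (intro card_inj_on_le) auto
  then have "real (card B) / real CARD('v) \<le> real (card ?K)"
    by (simp add: card_cartesian_product field_simps flip: of_nat_mult)
  moreover have "card B = card ({a \<in> B. P a} \<union> ?K)"
    by (rule arg_cong[of _ _ card]) auto
  then have "card B = card {a \<in> B. P a} + card ?K"
    using \<open>finite B\<close> by (subst (asm) card_Un_disjoint) auto
  ultimately show ?thesis
    by (simp add: algebra_simps add_divide_distrib)
qed

text \<open>By induction on \<open>k\<close>: the event \<open>P k\<close> is tested on the
  survivors of the earlier events, which form a set closed under changes at \<open>v k\<close>. An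
  event may depend on earlier coordinates but not on later ones.\<close>

lemma card_lines_le:
  fixes A :: "('i \<Rightarrow> 'v::finite) set"
  assumes "finite A"
    and closed: "\<And>a u x. a \<in> A \<Longrightarrow> u < k \<Longrightarrow> a(v u := x) \<in> A"
    and Q: "\<And>a u x. u < k \<Longrightarrow> Q (a(v u := x)) \<longleftrightarrow> Q a"
    and P: "\<And>a u u' x. u' < u \<Longrightarrow> u < k \<Longrightarrow> P u' (a(v u := x)) \<longleftrightarrow> P u' a"
    and kill: "\<And>a u. a \<in> A \<Longrightarrow> Q a \<Longrightarrow> u < k \<Longrightarrow> \<exists>x. \<not> P u (a(v u := x))"
  shows "real (card {a \<in> A. Q a \<and> (\<forall>u<k. P u a)}) \<le> (1 - 1 / real CARD('v)) ^ k * real (card A)"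
  using closed Q P kill
proof (induction k)
  case 0
  then show ?case using \<open>finite A\<close> by (auto intro!: card_mono)
next
  case (Suc k)
  let ?B = "{a \<in> A. Q a \<and> (\<forall>u<k. P u a)}"
  have "{a \<in> A. Q a \<and> (\<forall>u<Suc k. P u a)} = {a \<in> ?B. P k a}"
    by (auto simp: less_Suc_eq)
  moreover have "real (card {a \<in> ?B. P k a}) \<le> (1 - 1 / real CARD('v)) * real (card ?B)"
  proof (rule card_line_le[where v = "v k"])
    show "a(v k := x) \<in> ?B" if "a \<in> ?B" for a x
      using that Suc.prems(1)[of a k x] Suc.prems(2)[of k a x] Suc.prems(3)[of _ k a x]
      by (simp add: fun_upd_def)
    show "\<exists>x. \<not> P k (a(v k := x))" if "a \<in> ?B" for a
      using that Suc.prems(4)[of a k] by blast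
  qed (use \<open>finite A\<close> in simp)
  ultimately have "real (card {a \<in> A. Q a \<and> (\<forall>u<Suc k. P u a)}) \<le>
      (1 - 1 / real CARD('v)) * real (card ?B)"
    by simp
  also have "\<dots> \<le> (1 - 1 / real CARD('v)) * ((1 - 1 / real CARD('v)) ^ k * real (card A))"
    by (intro mult_left_mono Suc.IH Suc.prems) auto
  finally show ?case by (simp add: mult.assoc)
qed

text \<open>Averaging over \<open>a\<close>: after a union bound over \<open>X\<close>, counting bad
  triples by \<open>a\<close> or by \<open>(w, x)\<close> shows that not every \<open>a\<close> can
  exceed the bound.\<close>

lemma ex_few_bad:
  fixes c :: real
  assumes "finite A" "A \<noteq> {}" "finite W" "finite X"
    and le: "\<And>w x. w \<in> W \<Longrightarrow> x \<in> X \<Longrightarrow> real (card {a \<in> A. bad a w x}) \<le> c * real (card A)"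
  shows "\<exists>a\<in>A. real (card {w \<in> W. \<exists>x\<in>X. bad a w x}) \<le> real (card X) * c * real (card W)"
proof (rule ccontr)
  assume "\<not> ?thesis"
  then have "(\<Sum>a\<in>A. real (card X) * c * real (card W)) < (\<Sum>a\<in>A. real (card {w \<in> W. \<exists>x\<in>X. bad a w x}))"
    using assms(1,2) by (intro sum_strict_mono) (auto simp: not_le)
  also have "\<dots> \<le> (\<Sum>a\<in>A. \<Sum>x\<in>X. real (card {w \<in> W. bad a w x}))"
  proof (rule sum_mono)
    fix a
    have "{w \<in> W. \<exists>x\<in>X. bad a w x} = (\<Union>x\<in>X. {w \<in> W. bad a w x})" by auto
    then have "card {w \<in> W. \<exists>x\<in>X. bad a w x} \<le> (\<Sum>x\<in>X. card {w \<in> W. bad a w x})"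
      using card_UN_le[OF \<open>finite X\<close>] by metis
    then show "real (card {w \<in> W. \<exists>x\<in>X. bad a w x}) \<le> (\<Sum>x\<in>X. real (card {w \<in> W. bad a w x}))"
      by (simp flip: of_nat_sum)
  qed
  also have "\<dots> = (\<Sum>a\<in>A. \<Sum>x\<in>X. \<Sum>w\<in>W. if bad a w x then 1 else 0)"
    using \<open>finite W\<close> by (simp add: sum.If_cases Int_def)
  also have "\<dots> = (\<Sum>x\<in>X. \<Sum>w\<in>W. \<Sum>a\<in>A. if bad a w x then 1 else 0)"
    by (simp add: sum.swap[of _ _ A])
  also have "\<dots> = (\<Sum>x\<in>X. \<Sum>w\<in>W. real (card {a \<in> A. bad a w x}))"
    using \<open>finite A\<close> by (simp add: sum.If_cases Int_def)
  also have "\<dots> \<le> (\<Sum>x\<in>X. \<Sum>w\<in>W. c * real (card A))"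
    by (intro sum_mono le)
  finally show False by (simp add: algebra_simps)
qed

subsection \<open>Search trees\<close>

lemma height_Query_le: "height (Query q ts) \<le> Suc n \<longleftrightarrow> (\<forall>a. height (ts a) \<le> n)"
  by auto

text \<open>Binary search: querying the sum over one part selects a part with nonzero sum, a zero
  answer pointing to the complement because the total is nonzero. At the element \<open>x\<close>
  found, the search goes on with the tree \<open>C x\<close>.\<close>

lemma ex_nonzero_search_tree:
  fixes t :: "'x \<Rightarrow> 'q::comm_monoid_add" and C :: "'x \<Rightarrow> ('q, 'a::{finite,comm_monoid_add}, 'l) qtree"
  assumes "finite X" "X \<noteq> {}" "card X \<le> 2 ^ s"
    and C: "\<And>x. x \<in> X \<Longrightarrow> height (C x) \<le> k" "\<And>x. x \<in> X \<Longrightarrow> queries (C x) \<subseteq> Q"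
    and Q: "\<And>Y. Y \<subseteq> X \<Longrightarrow> sum t Y \<in> Q"
    and add: "\<And>w Y. w \<in> W \<Longrightarrow> Y \<subseteq> X \<Longrightarrow> w (sum t Y) = (\<Sum>x\<in>Y. w (t x))"
  shows "\<exists>T. queries T \<subseteq> Q \<and> height T \<le> k + s \<and>
    (\<forall>w\<in>W. (\<Sum>x\<in>X. w (t x)) \<noteq> 0 \<longrightarrow> (\<exists>x\<in>X. w (t x) \<noteq> 0 \<and> run T w = run (C x) w))"
  using assms
proof (induction s arbitrary: X)
  case 0
  then have "card X = 1"
    by (simp add: le_Suc_eq)
  then obtain x where "X = {x}"
    by (auto simp: card_1_singleton_iff)
  with 0 show ?case
    by (intro exI[of _ "C x"]) auto
next
  case (Suc s)
  show ?case
  proof (cases "card X \<le> 2 ^ s")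
    case True
    show ?thesis
      using Suc.IH[OF Suc.prems(1,2) True Suc.prems(4-7)] by (auto intro: le_SucI)
  next
    case False
    \<comment> \<open>Since \<open>2 ^ s < card X \<le> 2 ^ Suc s\<close>, a part of exactly
      \<open>2 ^ s\<close> elements leaves a nonempty remainder of at most \<open>2 ^ s\<close>
      elements.\<close>
    then obtain Y where Y: "Y \<subseteq> X" "card Y = 2 ^ s"
      by (meson nat_le_linear obtain_subset_with_card_n)
    let ?Z = "X - Y"
    have fin: "finite Y" "finite ?Z"
      using Y Suc.prems(1) finite_subset by auto
    have "card ?Z \<le> 2 ^ s" "?Z \<noteq> {}" "Y \<noteq> {}"
      using Y fin False Suc.prems(3) by (auto simp: card_Diff_subset)
    then obtain TY TZ where
      TY: "queries TY \<subseteq> Q" "height TY \<le> k + s"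
        "\<And>w. w \<in> W \<Longrightarrow> (\<Sum>x\<in>Y. w (t x)) \<noteq> 0 \<Longrightarrow> \<exists>x\<in>Y. w (t x) \<noteq> 0 \<and> run TY w = run (C x) w" and
      TZ: "queries TZ \<subseteq> Q" "height TZ \<le> k + s"
        "\<And>w. w \<in> W \<Longrightarrow> (\<Sum>x\<in>?Z. w (t x)) \<noteq> 0 \<Longrightarrow> \<exists>x\<in>?Z. w (t x) \<noteq> 0 \<and> run TZ w = run (C x) w"
      using Suc.IH[of Y] Suc.IH[of ?Z] Suc.prems(4-7) Y fin
      by (smt (verit, ccfv_threshold) Diff_subset order.refl subset_iff)
    have split: "(\<Sum>x\<in>X. w (t x)) = (\<Sum>x\<in>?Z. w (t x)) + (\<Sum>x\<in>Y. w (t x))" for w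
      using Y Suc.prems(1) by (simp add: sum.subset_diff)
    let ?T = "Query (sum t Y) (\<lambda>a. if a = 0 then TZ else TY)"
    have "\<exists>x\<in>X. w (t x) \<noteq> 0 \<and> run ?T w = run (C x) w"
      if w: "w \<in> W" "(\<Sum>x\<in>X. w (t x)) \<noteq> 0" for w
    proof (cases "(\<Sum>x\<in>Y. w (t x)) = 0")
      case True
      then show ?thesis
        using TZ(3)[OF w(1)] w(2) split[of w] Suc.prems(7)[OF w(1) Y(1)] by auto
    next
      case False
      then show ?thesis
        using TY(3)[OF w(1)] Suc.prems(7)[OF w(1) Y(1)] Y(1) by auto
    qed
    moreover have "queries ?T \<subseteq> Q"
      using TY(1) TZ(1) Suc.prems(6)[OF Y(1)] by (auto split: if_splits)
    moreover have "height ?T \<le> k + Suc s"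
      unfolding add_Suc_right height_Query_le using TY(2) TZ(2) by auto
    ultimately show ?thesis by blast
  qed
qed

text \<open>The candidates are tested from index \<open>k\<close> down to 1. If none of these
  vanishes, index 0 is the one left, and its label is returned without a query.\<close>

lemma ex_zero_search_tree:
  fixes f :: "nat \<Rightarrow> 'q" and l :: "nat \<Rightarrow> 'l"
  shows "\<exists>T :: ('q, 'a::{finite,zero}, 'l) qtree. queries T \<subseteq> f ` {..k} \<and> height T \<le> k \<and>
    (\<forall>w. (\<exists>u\<le>k. w (f u) = 0) \<longrightarrow> (\<exists>u\<le>k. w (f u) = 0 \<and> run T w = l u))"
proof (induction k)
  case 0
  show ?case by (intro exI[of _ "Leaf (l 0)"]) auto
next
  case (Suc k)
  then obtain T :: "('q, 'a, 'l) qtree" where T: "queries T \<subseteq> f ` {..k}" "height T \<le> k"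
    "\<And>w. (\<exists>u\<le>k. w (f u) = 0) \<Longrightarrow> (\<exists>u\<le>k. w (f u) = 0 \<and> run T w = l u)"
    by blast
  let ?T = "Query (f (Suc k)) (\<lambda>a. if a = 0 then Leaf (l (Suc k)) else T)"
  have "\<exists>u\<le>Suc k. w (f u) = 0 \<and> run ?T w = l u" if "\<exists>u\<le>Suc k. w (f u) = 0" for w
  proof (cases "w (f (Suc k)) = 0")
    case False
    then show ?thesis using that T(3)[of w] by (auto simp: le_Suc_eq)
  qed auto
  moreover have "queries ?T \<subseteq> f ` {..Suc k}"
    using T(1) by (auto simp: atMost_Suc split: if_splits)
  moreover have "height ?T \<le> Suc k"
    unfolding height_Query_le using T(2) by auto
  ultimately show ?case by blast
qed

subsection \<open>Designs\<close>

lemma polys_upto_0 [simp]: "0 \<in> polys_upto N d"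
  by (auto simp: polys_upto_def polys_def)

lemma polys_upto_add: "f \<in> polys_upto N d \<Longrightarrow> g \<in> polys_upto N d \<Longrightarrow> f + g \<in> polys_upto N d"
  using vars_add[of f g] deg_add_le[of f g] by (auto simp: polys_upto_def polys_def)

lemma polys_upto_sum:
  "(\<And>i. i \<in> I \<Longrightarrow> f i \<in> polys_upto N d) \<Longrightarrow> (\<Sum>i\<in>I. f i) \<in> polys_upto N d"
  by (induction I rule: infinite_finite_induct) (auto simp: polys_upto_add)

lemma specialize_in_polys_upto: "deg f \<le> d \<Longrightarrow> specialize N a f \<in> polys_upto N d"
  using deg_specialize_le[of N a f] specialize_in_polys[of N a f] by (auto simp: polys_upto_def)

context
  fixes N d :: nat and F :: "'p::prime_card fpoly set" and w
  assumes w: "design N F d w"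
begin

lemma design_Const: "w (Const x) = x"
  using w by (simp add: design_def)

lemma design_0: "w 0 = 0"
  using design_Const[of 0] by simp

lemma design_add: "f \<in> polys_upto N d \<Longrightarrow> g \<in> polys_upto N d \<Longrightarrow> w (f + g) = w f + w g"
  using w by (simp add: design_def)

lemma design_sum:
  "(\<And>i. i \<in> I \<Longrightarrow> f i \<in> polys_upto N d) \<Longrightarrow> w (\<Sum>i\<in>I. f i) = (\<Sum>i\<in>I. w (f i))"
  by (induction I rule: infinite_finite_induct) (auto simp: design_0 design_add polys_upto_sum)

text \<open>Additivity gives linearity because every scalar of the prime field is a multiple of
  1.\<close>

lemma design_scale:
  assumes "f \<in> polys_upto N d"
  shows "w (Const x * f) = x * w f"
proof -
  obtain n where n: "x = of_nat n"
    using surj_of_nat_mod_ring by blast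
  have "Const x = of_nat n"
    by (simp add: Const_def n)
  then have "w (Const x * f) = w (\<Sum>i<n. f)"
    by simp
  then show ?thesis
    unfolding n using design_sum[of "{..<n}" "\<lambda>_. f"] assms by (simp only: sum_constant card_lessThan)
qed

lemma design_ideal:
  "f \<in> F \<Longrightarrow> g \<in> polys_upto N d \<Longrightarrow> deg (f * g) \<le> d \<Longrightarrow> w (f * g) = 0"
  using w by (simp add: design_def)

end

subsection \<open>Factored extension polynomials\<close>

text \<open>The common polynomial \<open>q\<close> sits at index 0 of the same sequence, so that an
  extension polynomial is a plain product of \<open>h + 1\<close> factors and one search covers them
  all.\<close>

fun ext_factor ::
  "'p::prime_card fpoly \<Rightarrow> (nat \<Rightarrow> 'p fpoly) \<Rightarrow> (nat \<Rightarrow> nat) \<Rightarrow> nat \<Rightarrow> 'p fpoly" where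
  "ext_factor q b v 0 = q"
| "ext_factor q b v (Suc u) = b u - Var (v u) * q"

definition ext_factored ::
  "nat \<Rightarrow> nat \<Rightarrow> 'p::prime_card fpoly \<Rightarrow> 'p fpoly \<Rightarrow> (nat \<Rightarrow> 'p fpoly) \<Rightarrow> (nat \<Rightarrow> nat) \<Rightarrow> bool" where
  "ext_factored N h g q b v \<longleftrightarrow> g = (\<Prod>i\<le>h. ext_factor q b v i) \<and> inj_on v {..<h} \<and>
     (\<forall>u<h. N \<le> v u \<and> v u \<notin> vars q \<and> (\<forall>u'<h. v u \<notin> vars (b u')))"

text \<open>The summand \<open>j = index e\<close> is split off from every row and the rest of the
  row forms \<open>b u\<close>. The selected variables miss every \<open>b u'\<close> because all
  entries of \<open>rows e\<close> are distinct and none occurs in \<open>base e\<close>.\<close>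

lemma ext_poly_factored:
  assumes wf: "ext_wf h e" and disj: "ext_vars e \<inter> base_vars e = {}" and N: "\<And>r. r \<in> ext_vars e \<Longrightarrow> N \<le> r"
  shows "\<exists>q b v. ext_factored N h (ext_poly e) q b v"
proof -
  let ?m = "length (base e)" and ?i = "index e"
  let ?q = "base e ! ?i"
  let ?v = "\<lambda>u. rows e ! u ! ?i"
  let ?b = "\<lambda>u. 1 - (\<Sum>j\<in>{..<?m} - {?i}. Var (rows e ! u ! j) * base e ! j)"
  have i: "?i < ?m" and len: "length (rows e) = h" and dist: "distinct (concat (rows e))"
    using wf by (auto simp: ext_wf_def)
  have row: "length (rows e ! u) = ?m" if "u < h" for u
    using wf that len by (auto simp: ext_wf_def)
  have inj: "u = u' \<and> j = j'"
    if "u < h" "u' < h" "j < ?m" "j' < ?m" "rows e ! u ! j = rows e ! u' ! j'" for u u' j j'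
  proof -
    have "rows e ! u = rows e ! u'"
      using that row[of u] row[of u'] len dist unfolding distinct_concat_iff
      by (metis IntI empty_iff nth_mem)
    \<comment> \<open>A distinct concatenation does not exclude repeated empty rows; here rows have
      positive length because \<open>index e < length (base e)\<close>.\<close>
    moreover have "[] \<notin> set (rows e)"
      using wf i by (auto simp: ext_wf_def)
    then have "distinct (rows e)"
      using dist by (simp add: distinct_concat_iff)
    ultimately have "u = u'"
      using that len by (simp add: nth_eq_iff_index_eq)
    moreover have "distinct (rows e ! u)"
      using dist that len by (simp add: distinct_concat_iff)
    ultimately show ?thesis
      using that row[of u] by (simp add: nth_eq_iff_index_eq)
  qed
  have ext: "rows e ! u ! j \<in> ext_vars e" if "u < h" "j < ?m" for u j
    using that row[of u] len unfolding ext_vars_def set_concat by (metis UN_I nth_mem)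
  have base: "vars (base e ! j) \<subseteq> base_vars e" if "j < ?m" for j
    using that nth_mem by (fastforce simp: base_vars_def)
  have q: "?v u \<notin> vars ?q" if "u < h" for u
    using ext[OF that i] base[OF i] disj by blast
  have b: "?v u \<notin> vars (?b u')" if "u < h" "u' < h" for u u'
  proof
    assume "?v u \<in> vars (?b u')"
    then have "?v u \<in> (\<Union>j\<in>{..<?m} - {?i}. vars (Var (rows e ! u' ! j) * base e ! j))"
      using vars_minus[of 1] vars_sum by fastforce
    then obtain j where j: "j < ?m" "j \<noteq> ?i" "?v u \<in> vars (Var (rows e ! u' ! j) * base e ! j)"
      by auto
    then have "?v u = rows e ! u' ! j \<or> ?v u \<in> vars (base e ! j)"
      using vars_mult by fastforce
    then show False
      using inj[OF that i j(1)] j(2) base[OF j(1)] ext[OF that(1) i] disj by blast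
  qed
  have eq: "?b u - Var (?v u) * ?q = 1 - (\<Sum>j<?m. Var (rows e ! u ! j) * base e ! j)" for u
    using i by (subst (2) sum.remove[of _ ?i]) auto
  have "ext_poly e = (\<Prod>i\<le>h. ext_factor ?q ?b ?v i)"
    unfolding ext_poly_def len prod.atMost_shift ext_factor.simps eq by (rule refl)
  then have "ext_factored N h (ext_poly e) ?q ?b ?v"
    unfolding ext_factored_def using q b ext[OF _ i] N inj[OF _ _ i i] by (auto simp: inj_on_def)
  then show ?thesis by blast
qed

text \<open>Taking \<open>q = 1\<close> puts the constant 1 at index 0. No design vanishes on it, so
  a vanishing factor is always one of the \<open>g - Var r\<close>.\<close>

lemma uext_poly_factored:
  assumes "uext_wf N h e"
  shows "\<exists>q b v. ext_factored N h (uext_poly e) q b v"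
proof -
  let ?v = "\<lambda>u. snd (e ! u)" and ?b = "\<lambda>u. fst (e ! u)"
  have e: "length e = h" "distinct (map snd e)"
    "\<And>r g. r \<in> set (map snd e) \<Longrightarrow> g \<in> set (map fst e) \<Longrightarrow> r \<notin> vars g"
    "\<And>r. r \<in> set (map snd e) \<Longrightarrow> N \<le> r"
    using assms by (auto simp: uext_wf_def)
  have mem: "?v u \<in> set (map snd e)" "?b u \<in> set (map fst e)" if "u < h" for u
    using that e(1) by auto
  have "uext_poly e = (\<Prod>u<h. ?b u - Var (?v u))"
    by (simp add: uext_poly_def prod.list_conv_set_nth e(1) case_prod_beta atLeast0LessThan)
  then have "uext_poly e = (\<Prod>i\<le>h. ext_factor 1 ?b ?v i)"
    by (simp add: prod.atMost_shift)
  moreover have "inj_on ?v {..<h}"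
    using e(1,2) by (auto simp: inj_on_def distinct_conv_nth)
  ultimately have "ext_factored N h (uext_poly e) 1 ?b ?v"
    unfolding ext_factored_def using mem e(3,4) by simp
  then show ?thesis by blast
qed

text \<open>Lines run in the directions \<open>v 0, ..., v (k - 1)\<close>. Moving along
  \<open>v u\<close> fixes \<open>q\<close> and the factors \<open>Suc u'\<close> with
  \<open>u' < u\<close>, and changes the value of factor \<open>Suc u\<close> affinely, with slope
  minus the value of the specialized \<open>q\<close>.\<close>

lemma card_no_zero_factor_le:
  fixes q :: "'p::prime_card fpoly"
  assumes w: "design N F d w" and g: "ext_factored N h g q b v"
    and deg: "\<And>i. i \<le> h \<Longrightarrow> deg (ext_factor q b v i) \<le> d"
    and "k \<le> h" "finite V" "v ` {..<h} \<subseteq> V"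
  shows "real (card {a \<in> V \<rightarrow>\<^sub>E UNIV. \<forall>i\<le>k. w (specialize N a (ext_factor q b v i)) \<noteq> 0})
    \<le> (1 - 1 / real CARD('p)) ^ k * real (card (V \<rightarrow>\<^sub>E (UNIV :: 'p mod_ring set)))"
proof -
  let ?A = "V \<rightarrow>\<^sub>E (UNIV :: 'p mod_ring set)" and ?f = "ext_factor q b v"
  let ?P = "\<lambda>i a. w (specialize N a (?f i)) \<noteq> 0"
  have v: "N \<le> v u" "v u \<notin> vars q" "\<And>u'. u' < h \<Longrightarrow> v u \<notin> vars (b u')" if "u < h" for u
    using g that by (auto simp: ext_factored_def)
  have inj: "u = u'" if "v u = v u'" "u < h" "u' < h" for u u'
    using g that by (auto simp: ext_factored_def inj_on_def)
  have upd: "specialize N (a(v u := x)) p = specialize N a p" if "v u \<notin> vars p" for a u x p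
    using that by (intro specialize_cong) auto
  have "real (card {a \<in> ?A. ?P 0 a \<and> (\<forall>u<k. ?P (Suc u) a)})
    \<le> (1 - 1 / real CARD('p mod_ring)) ^ k * real (card ?A)"
  proof (rule card_lines_le[where v = v])
    show "finite ?A"
      using \<open>finite V\<close> by (intro finite_PiE) auto
    show "a(v u := x) \<in> ?A" if "a \<in> ?A" "u < k" for a u x
    proof -
      have "v u \<in> V" using that assms by auto
      then show ?thesis using PiE_fun_upd[of x "\<lambda>_. UNIV" "v u" a V] that by (simp add: insert_absorb)
    qed
    show "?P 0 (a(v u := x)) \<longleftrightarrow> ?P 0 a" if "u < k" for a u x
      using that \<open>k \<le> h\<close> by (simp add: upd v)
    show "?P (Suc u') (a(v u := x)) \<longleftrightarrow> ?P (Suc u') a" if "u' < u" "u < k" for a u u' x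
    proof -
      have "v u \<notin> vars (Var (v u') * q)"
        using vars_mult[of "Var (v u')" q] v(2)[of u] inj[of u u'] that \<open>k \<le> h\<close> by auto
      then have "v u \<notin> vars (?f (Suc u'))"
        using vars_minus[of "b u'" "Var (v u') * q"] v(3)[of u u'] that \<open>k \<le> h\<close> by auto
      then show ?thesis by (simp only: upd not_False_eq_True)
    qed
    show "\<exists>x. \<not> ?P (Suc u) (a(v u := x))" if "?P 0 a" "u < k" for a u
    proof -
      have u: "u < h" using that \<open>k \<le> h\<close> by simp
      \<comment> \<open>Raising the coordinate by \<open>y\<close> lowers the value of the factor by
        \<open>y * w (specialize N a q)\<close>, which is all of it.\<close>
      define y where "y = w (specialize N a (?f (Suc u))) / w (specialize N a q)"
      have shift: "specialize N (a(v u := x)) (?f (Suc u)) = specialize N a (b u) - Const x * specialize N a q" for x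
        using u v(1)[OF u] by (simp add: spec.lift_minus spec.lift_mult specialize_Var specialize_var_def v(2,3) upd)
      \<comment> \<open>The new factor is written as the old one plus a multiple of
        \<open>q\<close>; the degree hypothesis bounds both, so additivity of \<open>w\<close>
        applies.\<close>
      have "Const (a (v u)) = Const (a (v u) + y) + Const (- y)"
        unfolding Const_add[symmetric] by simp
      then have "specialize N (a(v u := a (v u) + y)) (?f (Suc u)) =
          specialize N a (?f (Suc u)) + Const (- y) * specialize N a q"
        using shift[of "a (v u)"] unfolding fun_upd_triv shift by (simp only: algebra_simps)
      also have "w \<dots> = w (specialize N a (?f (Suc u))) + - y * w (specialize N a q)"
      proof -
        have "specialize N a q \<in> polys_upto N d"
          using deg[of 0] by (intro specialize_in_polys_upto) auto
        moreover have "specialize N a (?f (Suc u)) \<in> polys_upto N d"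
          using deg[of "Suc u"] u by (intro specialize_in_polys_upto) auto
        moreover have "Const (- y) * specialize N a q \<in> polys_upto N d"
          using deg[of 0] deg_mult_le[of "Const (- y)" q]
          by (subst specialize_Const[of N a "- y", symmetric], subst spec.lift_mult[symmetric])
             (intro specialize_in_polys_upto, simp)
        ultimately show ?thesis
          by (simp add: design_add[OF w] design_scale[OF w])
      qed
      also have "\<dots> = 0"
        using that(1) by (simp add: y_def)
      finally show ?thesis by blast
    qed
  qed
  moreover have "(\<forall>i\<le>k. ?P i a) \<longleftrightarrow> ?P 0 a \<and> (\<forall>u<k. ?P (Suc u) a)" for a
    by (metis Suc_le_eq le0 not0_implies_Suc)
  ultimately show ?thesis by simp
qed

subsection \<open>Trees from refutations\<close>

context
  fixes N h d :: nat and F E :: "'p::prime_card fpoly set" and R :: "nat set" and L :: "'p fpoly \<Rightarrow> 'p fpoly"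
  assumes F: "F \<subseteq> polys N"
    and ref: "ns_refutation (F \<union> E \<union> field_eqs R) L"
    and deg: "ns_degree (F \<union> E \<union> field_eqs R) L = d"
    and R: "\<And>r. r \<in> R \<Longrightarrow> N \<le> r"
begin

text \<open>
  A polynomial of \<open>E\<close> may also belong to \<open>F\<close> or to the field equations; its term then vanishes
  under every design and must not be counted twice.
\<close>

definition active :: "'p fpoly set" where
  "active = {g \<in> E - (F \<union> field_eqs R). L g * g \<noteq> 0}"

lemma finite_active: "finite active"
  using ref by (auto simp: active_def ns_refutation_def)

lemma deg_term_le: "g \<in> F \<union> E \<union> field_eqs R \<Longrightarrow> deg (L g * g) \<le> d"
  unfolding deg[symmetric] ns_degree_def using ref by (intro Max_ge) (auto simp: ns_refutation_def)

text \<open>Under any assignment \<open>a\<close>, terms of \<open>F\<close> keep their factor in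
  \<open>F\<close> and vanish under \<open>w\<close>, field equations become 0, and the remaining
  terms must carry \<open>w 1 = 1\<close>.\<close>

lemma sum_active:
  assumes w: "design N F d w"
  shows "(\<Sum>g\<in>active. w (specialize N a (L g * g))) = 1"
proof -
  let ?G = "F \<union> E \<union> field_eqs R" and ?t = "\<lambda>g. specialize N a (L g * g)"
  have G: "finite ?G" "(\<Sum>g\<in>?G. L g * g) = 1"
    using ref by (auto simp: ns_refutation_def)
  have "w (?t g) = 0" if g: "g \<in> ?G - active" for g
  proof (cases "L g * g = 0")
    case True
    then show ?thesis by (simp only: spec.lift_0 design_0[OF w])
  next
    case False
    show ?thesis
    proof (cases "g \<in> F")
      case True
      have eq: "?t g = g * specialize N a (L g)"
        using True F by (simp add: spec.lift_mult specialize_ident subset_iff mult.commute)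
      \<comment> \<open>The design condition also wants the cofactor in the domain of
        \<open>w\<close>. Its degree is bounded through that of the product, which is why zero
        products are set apart.\<close>
      have "deg (L g) \<le> d"
        using False deg_term_le[of g] g deg_mult_eq[of "L g" g] by auto
      moreover have "deg (g * specialize N a (L g)) \<le> d"
        using deg_specialize_le[of N a "L g * g"] deg_term_le[of g] g eq by auto
      ultimately show ?thesis
        unfolding eq using True by (intro design_ideal[OF w] specialize_in_polys_upto) auto
    next
      case False
      then have "g \<in> field_eqs R"
        using g \<open>L g * g \<noteq> 0\<close> by (auto simp: active_def)
      then show ?thesis
        using R by (simp add: spec.lift_mult specialize_field_eqs design_0[OF w])
    qed
  qed
  then have "(\<Sum>g\<in>active. w (?t g)) = (\<Sum>g\<in>?G. w (?t g))"
    using G(1) by (intro sum.mono_neutral_left) (auto simp: active_def)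
  also have "\<dots> = w (\<Sum>g\<in>?G. ?t g)"
    by (rule design_sum[OF w, symmetric]) (intro specialize_in_polys_upto deg_term_le)
  also have "(\<Sum>g\<in>?G. ?t g) = Const 1"
    unfolding spec.lift_sum[symmetric] G(2) spec.lift_1 by simp
  finally show ?thesis
    by (simp only: design_Const[OF w])
qed

text \<open>Averaging fixes one assignment \<open>a\<close> for all designs, so the tree does not
  depend on \<open>w\<close>. The binary search for a term is continued by the search for a
  vanishing factor of that term.\<close>

lemma ex_conflict_tree:
  assumes fac: "\<And>g. g \<in> E \<Longrightarrow> \<exists>q b v. ext_factored N h g q b v"
    and "finite W" "W \<noteq> {}" and W: "\<And>w. w \<in> W \<Longrightarrow> design N F d w"
    and "k \<le> h" "card E \<le> 2 ^ s"
  shows "\<exists>T. queries T \<subseteq> polys_upto N d \<and> height T \<le> k + s \<and>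
    real (card {w \<in> W. \<not> conflict_pair N d w (run T w)}) \<le>
      real (card E) * (1 - 1 / real CARD('p)) ^ k * real (card W)"
proof -
  define c where "c = (1 - 1 / real CARD('p)) ^ k"
  have "c \<ge> 0" by (simp add: c_def)
  have E: "active \<subseteq> E" "finite E"
    using ref by (auto simp: active_def ns_refutation_def)
  obtain q b v where fact: "\<And>g. g \<in> E \<Longrightarrow> ext_factored N h g (q g) (b g) (v g)"
    using fac by metis
  define f where "f g = ext_factor (q g) (b g) (v g)" for g
  have prod: "g = (\<Prod>i\<le>h. f g i)" if "g \<in> active" for g
    using fact[of g] that E by (auto simp: ext_factored_def f_def)
  \<comment> \<open>Degrees add on nonzero products, so every factor of a nonzero term and its
    cofactor have degree at most \<open>d\<close>.\<close>
  have deg_split: "deg (f g i) \<le> d" "deg (L g * (\<Prod>j\<in>{..h} - {i}. f g j)) \<le> d"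
    and prod_split: "f g i * (L g * (\<Prod>j\<in>{..h} - {i}. f g j)) = L g * g"
    if "g \<in> active" "i \<le> h" for g i
  proof -
    show eq: "f g i * (L g * (\<Prod>j\<in>{..h} - {i}. f g j)) = L g * g"
      using that by (subst (3) prod) (simp_all add: prod.remove[of "{..h}" i])
    moreover have "L g * g \<noteq> 0"
      using that(1) by (simp add: active_def)
    ultimately have "f g i \<noteq> 0" "L g * (\<Prod>j\<in>{..h} - {i}. f g j) \<noteq> 0"
      by (metis mult_zero_left, metis mult_zero_right)
    then show "deg (f g i) \<le> d" "deg (L g * (\<Prod>j\<in>{..h} - {i}. f g j)) \<le> d"
      using deg_mult_eq[of "f g i" "L g * (\<Prod>j\<in>{..h} - {i}. f g j)"] deg_term_le[of g] that(1)
      unfolding eq by (simp_all add: active_def)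
  qed
  \<comment> \<open>Assignments vary on this finite set of extension variables and are
    \<open>undefined\<close> elsewhere, so there are finitely many to average over.\<close>
  define V where "V = (\<Union>g\<in>active. v g ` {..<h})"
  have "finite V"
    by (simp add: V_def finite_active)
  let ?A = "V \<rightarrow>\<^sub>E (UNIV :: 'p mod_ring set)"
  have "\<exists>a\<in>?A. real (card {w \<in> W. \<exists>g\<in>active. \<forall>i\<le>k. w (specialize N a (f g i)) \<noteq> 0}) \<le>
      real (card active) * c * real (card W)"
  proof (rule ex_few_bad)
    show "finite ?A" "?A \<noteq> {}"
      using \<open>finite V\<close> by (auto intro!: finite_PiE simp: PiE_eq_empty_iff)
    show "real (card {a \<in> ?A. \<forall>i\<le>k. w (specialize N a (f g i)) \<noteq> 0}) \<le> c * real (card ?A)"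
      if "w \<in> W" "g \<in> active" for w g
      unfolding c_def f_def using that E deg_split(1) \<open>finite V\<close> \<open>k \<le> h\<close>
      by (intro card_no_zero_factor_le[OF W fact]) (auto simp: V_def f_def)
  qed (use assms finite_active in auto)
  then obtain a where a: "real (card {w \<in> W. \<exists>g\<in>active. \<forall>i\<le>k. w (specialize N a (f g i)) \<noteq> 0}) \<le>
      real (card active) * c * real (card W)"
    by blast
  let ?t = "\<lambda>g. specialize N a (L g * g)"
  let ?l = "\<lambda>g i. (specialize N a (f g i), specialize N a (L g * (\<Prod>j\<in>{..h} - {i}. f g j)))"
  have t: "?t g \<in> polys_upto N d" if "g \<in> active" for g
    using that deg_term_le[of g] by (intro specialize_in_polys_upto) (auto simp: active_def)
  \<comment> \<open>The product of the pair is the term itself: \<open>w\<close> vanishes on the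
    first entry but not on the product.\<close>
  have conflict: "conflict_pair N d w (?l g i)"
    if "w (specialize N a (f g i)) = 0" "w (?t g) \<noteq> 0" "g \<in> active" "i \<le> h" for w g i
  proof -
    have "specialize N a (f g i) * specialize N a (L g * (\<Prod>j\<in>{..h} - {i}. f g j)) = ?t g"
      using prod_split[OF that(3,4)] by (simp only: spec.lift_mult[symmetric])
    then show ?thesis
      using that t[OF that(3)] deg_split[OF that(3,4)]
      by (simp add: conflict_pair_def specialize_in_polys_upto) (simp add: polys_upto_def)
  qed
  have "\<exists>T :: 'p ptree. queries T \<subseteq> (\<lambda>i. specialize N a (f g i)) ` {..k} \<and> height T \<le> k \<and>
    (\<forall>w. (\<exists>i\<le>k. w (specialize N a (f g i)) = 0) \<longrightarrow>
      (\<exists>i\<le>k. w (specialize N a (f g i)) = 0 \<and> run T w = ?l g i))" for g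
    by (rule ex_zero_search_tree)
  then obtain C :: "'p fpoly \<Rightarrow> 'p ptree" where C: "\<And>g. queries (C g) \<subseteq> (\<lambda>i. specialize N a (f g i)) ` {..k}"
    "\<And>g. height (C g) \<le> k"
    "\<And>g w. \<exists>i\<le>k. w (specialize N a (f g i)) = 0 \<Longrightarrow>
      \<exists>i\<le>k. w (specialize N a (f g i)) = 0 \<and> run (C g) w = ?l g i"
    by metis
  have "\<exists>T. queries T \<subseteq> polys_upto N d \<and> height T \<le> k + s \<and>
    (\<forall>w\<in>W. (\<Sum>g\<in>active. w (?t g)) \<noteq> 0 \<longrightarrow> (\<exists>g\<in>active. w (?t g) \<noteq> 0 \<and> run T w = run (C g) w))"
  proof (rule ex_nonzero_search_tree)
    show "active \<noteq> {}"
      using sum_active W \<open>W \<noteq> {}\<close> by fastforce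
    show "card active \<le> 2 ^ s"
      using card_mono[OF E(2,1)] \<open>card E \<le> 2 ^ s\<close> by simp
    show "queries (C g) \<subseteq> polys_upto N d" if "g \<in> active" for g
    proof -
      have "(\<lambda>i. specialize N a (f g i)) ` {..k} \<subseteq> polys_upto N d"
        using deg_split(1)[OF that] \<open>k \<le> h\<close> by (intro image_subsetI specialize_in_polys_upto) auto
      then show ?thesis using C(1)[of g] by blast
    qed
    show "sum ?t Y \<in> polys_upto N d" if "Y \<subseteq> active" for Y
      using that t by (intro polys_upto_sum) auto
    show "w (sum ?t Y) = (\<Sum>g\<in>Y. w (?t g))" if "w \<in> W" "Y \<subseteq> active" for w Y
      using that t by (intro design_sum[OF W]) auto
  qed (use finite_active C(2) in auto)
  then obtain T where T: "queries T \<subseteq> polys_upto N d" "height T \<le> k + s"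
    "\<And>w. w \<in> W \<Longrightarrow> \<exists>g\<in>active. w (?t g) \<noteq> 0 \<and> run T w = run (C g) w"
    using sum_active[OF W] by force
  have "conflict_pair N d w (run T w)"
    if w: "w \<in> W" and good: "\<And>g. g \<in> active \<Longrightarrow> \<exists>i\<le>k. w (specialize N a (f g i)) = 0" for w
  proof -
    obtain g where g: "g \<in> active" "w (?t g) \<noteq> 0" "run T w = run (C g) w"
      using T(3)[OF w] by blast
    then obtain i where "i \<le> k" "w (specialize N a (f g i)) = 0" "run (C g) w = ?l g i"
      using C(3)[OF good] by blast
    then show ?thesis
      using g conflict[of w g i] \<open>k \<le> h\<close> by simp
  qed
  then have "{w \<in> W. \<not> conflict_pair N d w (run T w)} \<subseteq>
      {w \<in> W. \<exists>g\<in>active. \<forall>i\<le>k. w (specialize N a (f g i)) \<noteq> 0}"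
    by blast
  then have "real (card {w \<in> W. \<not> conflict_pair N d w (run T w)}) \<le> real (card active) * c * real (card W)"
    using a \<open>finite W\<close> by (intro order.trans[OF of_nat_mono[OF card_mono] a]) auto
  also have "\<dots> \<le> real (card E) * c * real (card W)"
    using card_mono[OF E(2,1)] \<open>c \<ge> 0\<close> by (intro mult_right_mono) auto
  finally show ?thesis
    unfolding c_def using T(1,2) by blast
qed

lemma no_pseudo_solution_if_small:
  assumes fac: "\<And>g. g \<in> E \<Longrightarrow> \<exists>q b v. ext_factored N h g q b v"
    and "k \<le> h" "card E \<le> 2 ^ s" "real (k + s) \<le> e"
    and small: "real (card E) * (1 - 1 / real CARD('p)) ^ k < \<gamma>"
  shows "\<not> pseudo_solution N F d e \<gamma> W"
proof
  assume "pseudo_solution N F d e \<gamma> W"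
  then have W: "finite W" "W \<noteq> {}" "\<And>w. w \<in> W \<Longrightarrow> design N F d w"
    and sol: "\<And>T. is_tree N d e T \<Longrightarrow>
        real (card {w \<in> W. \<not> conflict_pair N d w (run T w)}) / real (card W) \<ge> \<gamma>"
    by (auto simp: pseudo_solution_def)
  then have "real (card W) > 0"
    by (simp add: card_gt_0_iff)
  obtain T where T: "queries T \<subseteq> polys_upto N d" "height T \<le> k + s"
    "real (card {w \<in> W. \<not> conflict_pair N d w (run T w)}) \<le>
      real (card E) * (1 - 1 / real CARD('p)) ^ k * real (card W)"
    using ex_conflict_tree[OF fac W assms(2,3)] by blast
  have "real (height T) \<le> real (k + s)"
    using T(2) by (simp only: of_nat_le_iff)
  then have "\<gamma> * real (card W) \<le> real (card {w \<in> W. \<not> conflict_pair N d w (run T w)})"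
    using sol[of T] T(1) \<open>real (k + s) \<le> e\<close> \<open>real (card W) > 0\<close>
    by (simp add: is_tree_def field_simps)
  also have "\<dots> < \<gamma> * real (card W)"
    using T(3) mult_strict_right_mono[OF small \<open>real (card W) > 0\<close>] by linarith
  finally show False by simp
qed

text \<open>
  For \<open>S = 1\<close> the second claim allows no query, but a conflict for a single design already
  contradicts \<open>\<gamma> = 1\<close>.
\<close>

lemma no_pseudo_solution_if_single:
  assumes fac: "\<And>g. g \<in> E \<Longrightarrow> \<exists>q b v. ext_factored N h g q b v"
    and "card E = 1" "h \<ge> 1"
  shows "\<not> pseudo_solution N F d 0 1 W"
proof
  assume sol: "pseudo_solution N F d 0 1 W"
  then obtain w where w: "w \<in> W" "design N F d w" and "finite W"
    by (auto simp: pseudo_solution_def)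
  \<comment> \<open>With \<open>k = 1\<close> and \<open>s = 0\<close> the bound for the single
    design \<open>w\<close> is \<open>1 - 1/p < 1\<close>, so \<open>T\<close> ends in a conflict
    pair for \<open>w\<close>.\<close>
  obtain T where T: "real (card {w' \<in> {w}. \<not> conflict_pair N d w' (run T w')}) \<le>
      real (card E) * (1 - 1 / real CARD('p)) ^ 1 * real (card {w})"
    using ex_conflict_tree[OF fac, of "{w}" 1 0] w(2) assms(2,3) by auto
  have "conflict_pair N d w (run T w)"
  proof (rule ccontr)
    assume "\<not> ?thesis"
    then have "{w' \<in> {w}. \<not> conflict_pair N d w' (run T w')} = {w}" by auto
    then show False using T assms(2) by simp
  qed
  then have "{w' \<in> W. \<not> conflict_pair N d w' (run T w)} \<subset> W"
    using w(1) by auto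
  then have "card {w' \<in> W. \<not> conflict_pair N d w' (run T w)} < card W"
    using \<open>finite W\<close> by (simp add: psubset_card_mono)
  \<comment> \<open>The tree \<open>T\<close> is traded for the leaf it reaches on \<open>w\<close>,
    which has height 0; the conflict for \<open>w\<close> alone keeps the ratio below 1.\<close>
  moreover have "is_tree N d 0 (Leaf (run T w))"
    by (simp add: is_tree_def)
  then have "real (card {w' \<in> W. \<not> conflict_pair N d w' (run T w)}) / real (card W) \<ge> 1"
    using sol unfolding pseudo_solution_def by (metis (no_types, lifting) Collect_cong run.simps(1))
  ultimately show False
    by (simp add: field_simps split: if_splits)
qed

text \<open>Without extension polynomials the sum of active values is empty, yet it would have to be
  1.\<close>

lemma no_design_if_empty:
  assumes "E = {}"
  shows "\<not> design N F d w"
proof -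
  have "active = {}"
    unfolding active_def using assms by simp
  then show ?thesis
    using sum_active[of w] by auto
qed

end

section \<open>Both kinds of refutation in factored form\<close>

lemma stratified_ext_poly_factored:
  assumes "stratified N h D" "e \<in> D"
  shows "\<exists>q b v. ext_factored N h (ext_poly e) q b v" and "\<And>r. r \<in> ext_vars e \<Longrightarrow> N \<le> r"
proof -
  obtain l lev where D: "D = (\<Union>t\<in>{1..l}. lev t)"
    and lev: "\<And>t e. t \<in> {1..l} \<Longrightarrow> e \<in> lev t \<Longrightarrow>
      base_vars e \<subseteq> vars_below N lev t \<and> ext_vars e \<inter> vars_below N lev t = {}"
    using assms(1) unfolding stratified_def by metis
  have below: "{..<N} \<subseteq> vars_below N lev t" for t
    by (simp add: vars_below_def)
  obtain t where "t \<in> {1..l}" "e \<in> lev t"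
    using assms(2) D by blast
  \<comment> \<open>The variables below a level include the base variables of that level and all
    indices under \<open>N\<close>, so one disjointness condition gives both facts.\<close>
  with lev[of t e] below[of t] have "ext_vars e \<inter> base_vars e = {}" "ext_vars e \<inter> {..<N} = {}"
    by blast+
  moreover show "N \<le> r" if "r \<in> ext_vars e" for r
    using that \<open>ext_vars e \<inter> {..<N} = {}\<close> by (meson disjoint_iff lessThan_iff not_le)
  ultimately show "\<exists>q b v. ext_factored N h (ext_poly e) q b v"
    using assms by (intro ext_poly_factored) (auto simp: stratified_def)
qed

lemma refutation_factored:
  assumes "ens_refutation N F h E L d \<or> uens_refutation N F h E L d"
  obtains R where "ns_refutation (F \<union> E \<union> field_eqs R) L" "ns_degree (F \<union> E \<union> field_eqs R) L = d"
    "\<And>r. r \<in> R \<Longrightarrow> N \<le> r" "\<And>g. g \<in> E \<Longrightarrow> \<exists>q b v. ext_factored N h g q b v"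
  using assms
proof
  assume "ens_refutation N F h E L d"
  then obtain D where "stratified N h D" "E = ext_poly ` D"
    "ns_refutation (F \<union> E \<union> field_eqs (\<Union>e\<in>D. ext_vars e)) L"
    "ns_degree (F \<union> E \<union> field_eqs (\<Union>e\<in>D. ext_vars e)) L = d"
    by (auto simp: ens_refutation_def Let_def)
  then show thesis
    using stratified_ext_poly_factored[of N h D] by (intro that[of "\<Union>e\<in>D. ext_vars e"]) auto
next
  assume "uens_refutation N F h E L d"
  then obtain D where D: "\<And>e. e \<in> D \<Longrightarrow> uext_wf N h e" "E = uext_poly ` D"
    "ns_refutation (F \<union> E \<union> field_eqs (\<Union>e\<in>D. set (map snd e))) L"
    "ns_degree (F \<union> E \<union> field_eqs (\<Union>e\<in>D. set (map snd e))) L = d"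
    unfolding uens_refutation_def Let_def by blast
  show thesis
  proof (rule that[OF D(3,4)])
    show "N \<le> r" if "r \<in> (\<Union>e\<in>D. set (map snd e))" for r
      using that D(1) unfolding uext_wf_def by blast
    show "\<exists>q b v. ext_factored N h g q b v" if "g \<in> E" for g
      using that D(1,2) uext_poly_factored by blast
  qed
qed

subsection \<open>Numerical estimates\<close>

lemma one_minus_inverse_power_le:
  fixes p :: real
  assumes "p \<ge> 1"
  shows "(1 - 1 / p) ^ k \<le> exp (- (real k / p))"
proof -
  have "(1 - 1 / p) ^ k \<le> exp (- 1 / p) ^ k"
    using assms exp_ge_add_one_self[of "- 1 / p"] by (intro power_mono) auto
  then show ?thesis
    by (simp flip: exp_of_nat_mult)
qed

text \<open>Strictness matters where \<open>exp (h / p) \<ge> S ^ 2\<close> leaves no slack: it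
  yields \<open>S * (1 - 1/p) ^ h < 1 / S\<close>.\<close>

lemma one_minus_inverse_power_less:
  fixes p :: real
  assumes "p \<ge> 1" "k \<ge> 1"
  shows "(1 - 1 / p) ^ k < exp (- (real k / p))"
proof -
  have "1 - 1 / p < exp (- (1 / p))"
    using assms by (intro exp_minus_greater[THEN iffD2]) auto
  then have "(1 - 1 / p) ^ k < exp (- 1 / p) ^ k"
    using assms by (intro power_strict_mono) auto
  then show ?thesis
    by (simp flip: exp_of_nat_mult)
qed

lemma ln_2_le_three_quarters: "ln 2 \<le> (3 / 4 :: real)"
proof -
  have "(2::real) \<le> 1 + 3 / 4 + (3 / 4)\<^sup>2 / 2"
    by (simp add: power2_eq_square)
  also have "\<dots> \<le> exp (3 / 4)"
    by (rule exp_lower_Taylor_quadratic) simp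
  finally show ?thesis
    by (simp add: ln_le_cancel_iff[of 2 "exp (3 / 4)", simplified])
qed

lemma real_nat_ceiling_log_less:
  assumes "S \<ge> 1"
  shows "real (nat \<lceil>log 2 (real S)\<rceil>) < log 2 (real S) + 1"
proof -
  have "0 \<le> log 2 (real S)"
    using assms by simp
  then show ?thesis
    by (subst of_nat_nat) (use ceiling_correct[of "log 2 (real S)"] in auto)
qed

lemma le_power_ceiling_log:
  assumes "S \<ge> 1"
  shows "S \<le> 2 ^ nat \<lceil>log 2 (real S)\<rceil>"
proof -
  have "log 2 (real S) \<le> real (nat \<lceil>log 2 (real S)\<rceil>)"
    by (rule real_nat_ceiling_ge)
  then have "real S \<le> 2 powr real (nat \<lceil>log 2 (real S)\<rceil>)"
    using assms by (subst (asm) log_le_iff) auto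
  also have "\<dots> = real (2 ^ nat \<lceil>log 2 (real S)\<rceil>)"
    by (simp add: powr_realpow)
  finally show ?thesis by (simp only: of_nat_le_iff)
qed

text \<open>With \<open>x = log 2 S\<close> and \<open>ln 2 \<le> 3/4\<close>, \<open>h\<close>
  stays below \<open>3/2 * p * x + 1\<close>. As \<open>p * x / 2 \<ge> x\<close>, it suffices that
  \<open>x\<close> rounded up, plus 1, is at most \<open>2 * x\<close>; this is checked in three
  ranges of \<open>S\<close>.\<close>

lemma height_bound:
  fixes p :: real
  assumes "p \<ge> 2" "S \<ge> 2" and h: "real h - 1 < 2 * p * ln (real S)"
  shows "real (h + nat \<lceil>log 2 (real S)\<rceil>) \<le> (2 * p + 1) * log 2 (real S)"
proof -
  define x where "x = log 2 (real S)"
  have "x \<ge> 1"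
    using \<open>S \<ge> 2\<close> by (simp add: x_def le_log_iff)
  have "ln (real S) = ln 2 * x"
    using \<open>S \<ge> 2\<close> by (simp add: x_def log_def)
  then have "ln (real S) \<le> 3 / 4 * x"
    using ln_2_le_three_quarters \<open>x \<ge> 1\<close> by (simp add: mult_right_mono)
  then have "2 * p * ln (real S) \<le> 2 * p * (3 / 4 * x)"
    using \<open>p \<ge> 2\<close> by (intro mult_left_mono) auto
  then have h': "real h < 3 / 2 * (p * x) + 1"
    using h by simp
  have px: "p * x \<ge> 2 * x"
    using \<open>p \<ge> 2\<close> \<open>x \<ge> 1\<close> by (simp add: mult_right_mono)
  consider "S = 2" | "S = 3" | "S \<ge> 4"
    using \<open>S \<ge> 2\<close> by linarith
  then have "real h + real (nat \<lceil>x\<rceil>) \<le> 2 * (p * x) + x"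
  proof cases
    case 1
    then have "x = 1" by (simp add: x_def)
    then show ?thesis
      using h' px by simp
  next
    case 2
    \<comment> \<open>Here \<open>2 * x = log 2 9 \<ge> log 2 8 = 3\<close>, while
      \<open>x \<le> log 2 4 = 2\<close> bounds the rounded value.\<close>
    have "2 * x = log 2 (3 ^ 2)"
      unfolding x_def 2 by (subst log_nat_power) auto
    moreover have "log 2 (2 ^ 3) \<le> log 2 (3 ^ 2 :: real)"
      by (subst log_le_cancel_iff) auto
    ultimately have "2 * x \<ge> 3"
      by (simp only: log_pow_cancel)
    moreover have "x \<le> log 2 (2 ^ 2)"
      unfolding x_def 2 by (subst log_le_cancel_iff) auto
    then have "nat \<lceil>x\<rceil> \<le> 2"
      by (simp only: log_pow_cancel) (simp add: ceiling_le_iff)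
    then have "real (nat \<lceil>x\<rceil>) \<le> 2" by linarith
    ultimately show ?thesis
      using h' px by linarith
  next
    case 3
    have "log 2 (2 ^ 2) \<le> x"
      unfolding x_def using 3 by (subst log_le_cancel_iff) auto
    then have "x \<ge> 2" by (simp only: log_pow_cancel)
    moreover have "real (nat \<lceil>x\<rceil>) < x + 1"
      unfolding x_def using \<open>S \<ge> 2\<close> by (intro real_nat_ceiling_log_less) simp
    ultimately show ?thesis
      using h' px by linarith
  qed
  then show ?thesis
    by (simp add: x_def distrib_right mult.assoc)
qed

section \<open>Choice of the tree parameters in the two claims\<close>

theorem theorem3p2:
  fixes N h d S :: nat
    and F E :: "'p::prime_card fpoly set"
    and L :: "'p fpoly \<Rightarrow> 'p fpoly"
  assumes "finite F" and "F \<subseteq> polys N"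
    and "\<And>i. i < N \<Longrightarrow> Var i ^ 2 - Var i \<in> F"
    and "ens_refutation N F h E L d \<or> uens_refutation N F h E L d"
    and "S = card E"
  shows "(exp (real h / real CARD('p)) \<ge> 2 * real S ^ 2 \<longrightarrow>
            \<not> (\<exists>\<Omega>. pseudo_solution N F d (real h + log 2 (real S)) (inverse (real S)) \<Omega>)) \<and>
         (exp (real h / real CARD('p)) \<ge> real S ^ 2 \<and>
          (\<forall>k\<ge>1. exp (real k / real CARD('p)) \<ge> real S ^ 2 \<longrightarrow> h \<le> k) \<longrightarrow>
            \<not> (\<exists>\<Omega>. pseudo_solution N F d ((2 * real CARD('p) + 1) * log 2 (real S))
                     (inverse (real S)) \<Omega>))"
proof -
  obtain R where R: "ns_refutation (F \<union> E \<union> field_eqs R) L"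
    "ns_degree (F \<union> E \<union> field_eqs R) L = d" "\<And>r. r \<in> R \<Longrightarrow> N \<le> r"
    and fac: "\<And>g. g \<in> E \<Longrightarrow> \<exists>q b v. ext_factored N h g q b v"
    using refutation_factored[OF assms(4)] by blast
  note ref = \<open>F \<subseteq> polys N\<close> R
  let ?p = "real CARD('p)" and ?s = "nat \<lceil>log 2 (real S)\<rceil>"
  have p: "?p \<ge> 2"
    using prime_ge_2_nat[OF prime_card[where ?'a = 'p]] by simp
  show ?thesis
  proof (cases "S = 0")
    \<comment> \<open>Here \<open>inverse (real S)\<close> is 0, so no probability bound can fail;
      the contradiction is that no design exists at all.\<close>
    case True
    moreover have "finite E"
      using R(1) by (simp add: ns_refutation_def)
    ultimately have "\<not> design N F d w" for w
      using no_design_if_empty[OF ref] \<open>S = card E\<close> by simp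
    then show ?thesis
      unfolding pseudo_solution_def by blast
  next
    case False
    then have S: "S \<ge> 1" by simp
    show ?thesis
    proof (intro conjI impI notI; elim exE conjE)
      fix W
      assume exp_ge: "exp (real h / ?p) \<ge> 2 * real S ^ 2"
        and sol: "pseudo_solution N F d (real h + log 2 (real S)) (inverse (real S)) W"
      have "real S ^ 2 \<ge> 1"
        using S by simp
      \<comment> \<open>At \<open>h = 0\<close> the left side would be 1, below
        \<open>2 * S ^ 2\<close>. So \<open>h - 1\<close> is a true predecessor in what
        follows.\<close>
      then have "h \<noteq> 0"
        using exp_ge by (intro notI) simp
      \<comment> \<open>Using the exponent \<open>h - 1\<close> in place of \<open>h\<close> costs a
        factor \<open>exp (1/p)\<close>, which the 2 in the hypothesis absorbs.\<close>
      have "exp (1 / ?p) < 2"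
      proof -
        have "exp (1 / ?p) \<le> exp (1 / 2)"
          using p by (simp add: field_simps)
        moreover have "exp (1 / 2 :: real) ^ 2 = exp 1"
          by (simp flip: exp_of_nat_mult)
        then have "exp (1 / 2 :: real) ^ 2 < 2 ^ 2"
          using exp_le by simp
        then have "exp (1 / 2 :: real) < 2"
          by (rule power_less_imp_less_base) simp
        ultimately show ?thesis by (rule le_less_trans)
      qed
      have "(1 - 1 / ?p) ^ (h - 1) \<le> exp (- (real (h - 1) / ?p))"
        using p by (intro one_minus_inverse_power_le) simp
      also have "\<dots> = exp (1 / ?p) / exp (real h / ?p)"
        using \<open>h \<noteq> 0\<close> by (simp add: exp_diff[symmetric] of_nat_diff diff_divide_distrib)
      also have "\<dots> < 2 / exp (real h / ?p)"
        using \<open>exp (1 / ?p) < 2\<close> by (intro divide_strict_right_mono) auto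
      also have "\<dots> \<le> 2 / (2 * real S ^ 2)"
        using exp_ge S by (intro divide_left_mono) auto
      finally have "real S * (1 - 1 / ?p) ^ (h - 1) < inverse (real S)"
        using S by (simp add: field_simps power2_eq_square)
      moreover have "real (h - 1 + ?s) \<le> real h + log 2 (real S)"
        using real_nat_ceiling_log_less[OF S] \<open>h \<noteq> 0\<close> by (simp add: of_nat_diff)
      ultimately show False
        using no_pseudo_solution_if_small[OF ref fac, of "h - 1" ?s] le_power_ceiling_log[OF S] sol
          \<open>S = card E\<close> by simp
    next
      fix W
      assume exp_ge: "exp (real h / ?p) \<ge> real S ^ 2"
        and minimal: "\<forall>k\<ge>1. exp (real k / ?p) \<ge> real S ^ 2 \<longrightarrow> h \<le> k"
        and sol: "pseudo_solution N F d ((2 * ?p + 1) * log 2 (real S)) (inverse (real S)) W"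
      \<comment> \<open>An ENS-refutation has \<open>h \<ge> 1\<close> by definition; a
        UENS-refutation with \<open>h = 0\<close> would have fewer than \<open>exp 0 = 1\<close>
        extension polynomials.\<close>
      have "h \<ge> 1"
      proof (rule ccontr)
        assume "\<not> h \<ge> 1"
        then have "uens_refutation N F h E L d" "h = 0"
          using assms(4) by (auto simp: ens_refutation_def)
        then show False
          using S \<open>S = card E\<close> by (auto simp: uens_refutation_def)
      qed
      show False
      proof (cases "S = 1")
        case True
        then show False
          using no_pseudo_solution_if_single[OF ref fac _ \<open>h \<ge> 1\<close>] sol \<open>S = card E\<close> by simp
      next
        case False
        then have S2: "S \<ge> 2" using S by simp
        have "real h - 1 < 2 * ?p * ln (real S)"
        \<comment> \<open>Minimality is applied to \<open>h - 1\<close> but concerns only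
          \<open>k \<ge> 1\<close>, hence \<open>h = 1\<close> is treated apart.\<close>
        proof (cases "h = 1")
          case True
          then show ?thesis using S2 p by simp
        next
          case False
          then have "exp (real (h - 1) / ?p) < real S ^ 2"
            using minimal[rule_format, of "h - 1"] \<open>h \<ge> 1\<close> by linarith
          then have "real (h - 1) / ?p < ln (real S ^ 2)"
            using S by (subst exp_less_cancel_iff[symmetric]) simp
          then show ?thesis
            using p S \<open>h \<ge> 1\<close> by (simp add: ln_realpow field_simps of_nat_diff)
        qed
        then have "real (h + ?s) \<le> (2 * ?p + 1) * log 2 (real S)"
          by (rule height_bound[OF p S2])
        moreover have "(1 - 1 / ?p) ^ h < 1 / real S ^ 2"
        proof -
          have "(1 - 1 / ?p) ^ h < exp (- (real h / ?p))"
            using p \<open>h \<ge> 1\<close> by (intro one_minus_inverse_power_less) auto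
          also have "\<dots> = 1 / exp (real h / ?p)"
            by (simp add: exp_minus inverse_eq_divide)
          also have "\<dots> \<le> 1 / real S ^ 2"
            using exp_ge S by (intro divide_left_mono) auto
          finally show ?thesis .
        qed
        then have "real S * (1 - 1 / ?p) ^ h < inverse (real S)"
          using S by (simp add: field_simps power2_eq_square)
        ultimately show False
          using no_pseudo_solution_if_small[OF ref fac, of h ?s] le_power_ceiling_log[OF S] sol
            \<open>S = card E\<close> by simp
      qed
    qed
  qed
qed

end
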